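(* Let $(\Omega,\mathcal F,\mu)$ be a measure space, $(\mathcal V,\langle\cdot,\cdot\rangle)$ a Hilbert space, $\{u_n\}_{n\ge 0}$ an orthonormal system in $L^2$ (with $u_n:\Omega\to\mathcal V$), and $\{c_n\}_{n\ge0}$ a sequence of numbers with $$\sum_{n=0}^\infty (\log_2(n+1))^2|c_n|^2<\infty .$$ Let $X$ be the partial sum process $X_n(\omega)=\sum_{k=0}^n c_ku_k(\omega)$, and let $\mathbf X=(X,A(X))$ be $X$ enhanced by its area process. Then $\mathbf X$ is a geometric $2$-rough process, and $$\int_\Omega \|\mathbf X(\omega)\|_{G^{(2)}}^2\,\mu(d\omega)\le 121\sum_{n=0}^\infty(\log_2(n+1))^2|c_n|^2 .$$ Moreover, $(\log_2(n+1))^2$ cannot be replaced by $o((\log_2(n+1))^2)$ in the condition: for every positive non-decreasing sequence $\{w(n)\}_{n\ge0}$ with $w(n)=o((\log_2(n+1))^2)$ as $n\to\infty$, there exist an orthonormal system $\{u_n\}$ in $L^2$ and numbers $\{c_n\}$ with $\sum_n w(n)|c_n|^2<\infty$ such that the partial sum process of $\sum_n c_nu_n$ enhanced by its area process is not a geometric $2$-rough process.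
   Context: $\mathbb N=\{0,1,2,\dots\}$, $\bigtriangleup_{\mathbb N}=\{(i,j)\in\mathbb N^2: i\le j\}$. Orthonormal system in $L^2$: measurable maps $u_n:(\Omega,\mathcal F,\mu)\to\mathcal V$, $n\in\mathbb N$, from a measure space to a Hilbert space with $\int_\Omega\langle u_n(\omega),u_m(\omega)\rangle\,\mu(d\omega)=\delta_{mn}$ for all $n,m$. $\mathcal V\otimes\mathcal V$ carries a norm with $\|u\otimes v\|\le\|u\|\|v\|$ for all $u,v\in\mathcal V$; $\mathcal V^{\otimes2}$ is its completion; $[u,v]:=u\otimes v-v\otimes u$. $p$-variation: for $\alpha:\bigtriangleup_{\mathbb N}\to E$ ($E$ a Banach space) with $\alpha(k,k)=0$ and $p\in[1,\infty)$, $\|\alpha\|_{p\text{-}var}:=\sup_{N\ge1}\big(\sup_{0\le k_0<\cdots<k_n\le N}\sum_{j=0}^{n-1}\|\alpha(k_j,k_{j+1})\|^p\big)^{1/p}$. A function $\gamma:\mathbb N\to E$ is regarded as a function on $\bigtriangleup_{\mathbb N}$ via $(k_1,k_2)\mapsto\gamma(k_1)-\gamma(k_2)$. Area: for $\gamma:\mathbb N\to\mathcal V$, $A(\gamma):\bigtriangleup_{\mathbb N}\to\mathcal V^{\otimes2}$ is $A(\gamma)(k_1,k_2)=0$ if $k_2\in\{k_1,k_1+1\}$, and for $k_2\ge k_1+2$, $A(\gamma)(k_1,k_2)=\frac12\sum_{k_1\le j_1<j_2\le k_2-1}[\gamma(j_1+1)-\gamma(j_1),\gamma(j_2+1)-\gamma(j_2)]$.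 The area process of a process $X$ indexed by $\mathbb N$ is $(A(X))(\omega):=A(X(\omega))$. $2$-rough norm: $\|(\gamma,\alpha)\|_{G^{(2)}}:=(\|\gamma\|_{2\text{-}var}^2+\|\alpha\|_{1\text{-}var})^{1/2}$. The pair $(\gamma,A(\gamma))$ is a geometric $2$-rough path if $\|(\gamma,A(\gamma))\|_{G^{(2)}}<\infty$. $(X,A(X))$ is a geometric $2$-rough process if $(X(\omega),A(X(\omega)))$ is a geometric $2$-rough path for $\mu$-almost every $\omega$. *)

theory Defs
  imports
    "HOL-Analysis.Analysis"
    "HOL-Analysis.Finite_Function_Topology"
    "HOL-Library.Landau_Symbols"
begin

section \<open>The algebraic tensor square\<close>

text \<open>
  The tensor square of \<open>'v\<close> is the free real vector space on \<open>'v \<times> 'v\<close> (finitely supported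
  functions with their pointwise vector space structure) modulo the span of the bilinearity
  relators.
\<close>

definition tensor_relators :: "('v::real_vector \<times> 'v \<Rightarrow>\<^sub>0 real) set" where
  "tensor_relators =
     {Poly_Mapping.single (u + u', v) 1 - Poly_Mapping.single (u, v) 1 - Poly_Mapping.single (u', v) 1
        | u u' v. True} \<union>
     {Poly_Mapping.single (u, v + v') 1 - Poly_Mapping.single (u, v) 1 - Poly_Mapping.single (u, v') 1
        | u v v'. True} \<union>
     {Poly_Mapping.single (a *\<^sub>R u, v) 1 - a *\<^sub>R Poly_Mapping.single (u, v) 1 | a u v. True} \<union>
     {Poly_Mapping.single (u, a *\<^sub>R v) 1 - a *\<^sub>R Poly_Mapping.single (u, v) 1 | a u v. True}"

definition tensor_eq :: "('v::real_vector \<times> 'v \<Rightarrow>\<^sub>0 real) \<Rightarrow> ('v \<times> 'v \<Rightarrow>\<^sub>0 real) \<Rightarrow> bool" where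
  "tensor_eq x y \<longleftrightarrow> x - y \<in> span tensor_relators"

lemma equivp_tensor_eq: "equivp (tensor_eq :: ('v::real_vector \<times> 'v \<Rightarrow>\<^sub>0 real) \<Rightarrow> _)"
  (is "equivp ?R")
proof (rule equivpI)
  show "reflp ?R"
    by (auto simp: reflp_def tensor_eq_def span_zero)
  show "symp ?R"
    unfolding symp_def tensor_eq_def by (metis minus_diff_eq span_neg)
  show "transp ?R"
  proof (rule transpI)
    fix x y z :: "'v \<times> 'v \<Rightarrow>\<^sub>0 real"
    assume "tensor_eq x y" "tensor_eq y z"
    then have "(x - y) + (y - z) \<in> span tensor_relators"
      unfolding tensor_eq_def by (rule span_add)
    then show "tensor_eq x z" by (simp add: tensor_eq_def)
  qed
qed

quotient_type (overloaded) 'v tensor_square = "('v::real_vector \<times> 'v) \<Rightarrow>\<^sub>0 real" / tensor_eq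
  by (rule equivp_tensor_eq)

instantiation tensor_square :: (real_vector) real_vector
begin

lift_definition zero_tensor_square :: "'a tensor_square" is 0 .

lift_definition plus_tensor_square :: "'a tensor_square \<Rightarrow> 'a tensor_square \<Rightarrow> 'a tensor_square"
  is "(+)"
proof -
  fix a b c d :: "'a \<times> 'a \<Rightarrow>\<^sub>0 real"
  assume "tensor_eq a b" "tensor_eq c d"
  then have "(a - b) + (c - d) \<in> span tensor_relators"
    unfolding tensor_eq_def by (rule span_add)
  then show "tensor_eq (a + c) (b + d)" by (simp add: tensor_eq_def add_diff_add)
qed

lift_definition uminus_tensor_square :: "'a tensor_square \<Rightarrow> 'a tensor_square"
  is uminus
proof -
  fix a b :: "'a \<times> 'a \<Rightarrow>\<^sub>0 real"
  assume "tensor_eq a b"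
  then have "- (a - b) \<in> span tensor_relators"
    unfolding tensor_eq_def by (rule span_neg)
  then show "tensor_eq (- a) (- b)" by (simp add: tensor_eq_def minus_diff_minus)
qed

lift_definition minus_tensor_square :: "'a tensor_square \<Rightarrow> 'a tensor_square \<Rightarrow> 'a tensor_square"
  is "(-)"
proof -
  fix a b c d :: "'a \<times> 'a \<Rightarrow>\<^sub>0 real"
  assume "tensor_eq a b" "tensor_eq c d"
  then have "(a - b) - (c - d) \<in> span tensor_relators"
    unfolding tensor_eq_def by (rule span_diff)
  moreover have "(a - b) - (c - d) = (a - c) - (b - d)" by (simp add: algebra_simps)
  ultimately show "tensor_eq (a - c) (b - d)" by (simp only: tensor_eq_def)
qed

lift_definition scaleR_tensor_square :: "real \<Rightarrow> 'a tensor_square \<Rightarrow> 'a tensor_square"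
  is "(*\<^sub>R)"
  by (simp add: tensor_eq_def span_scale flip: scaleR_diff_right)

instance
proof
  fix x y z :: "'a tensor_square" and a b :: real
  show "x + y + z = x + (y + z)"
    by transfer (simp add: tensor_eq_def span_zero add.assoc)
  show "x + y = y + x"
    by transfer (simp add: tensor_eq_def span_zero add.commute)
  show "0 + x = x" "- x + x = 0"
    by (transfer, simp add: tensor_eq_def span_zero)+
  show "x - y = x + - y"
    by transfer (simp add: tensor_eq_def span_zero)
  show "a *\<^sub>R (x + y) = a *\<^sub>R x + a *\<^sub>R y"
    by transfer (simp add: tensor_eq_def span_zero scaleR_add_right)
  show "(a + b) *\<^sub>R x = a *\<^sub>R x + b *\<^sub>R x"
    by transfer (simp add: tensor_eq_def span_zero scaleR_add_left)
  show "a *\<^sub>R b *\<^sub>R x = (a * b) *\<^sub>R x" "1 *\<^sub>R x = x"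
    by (transfer, simp add: tensor_eq_def span_zero)+
qed

end

lift_definition tensor :: "'v::real_vector \<Rightarrow> 'v \<Rightarrow> 'v tensor_square"
  is "\<lambda>u v. Poly_Mapping.single (u, v) 1" .

lemma tensor_relatorI:
  "r \<in> tensor_relators \<Longrightarrow> r = x - y \<Longrightarrow> tensor_eq x y"
  by (simp add: tensor_eq_def span_base)

lemma tensor_add_left: "tensor (u + u') v = tensor u v + tensor u' v"
proof (transfer, rule tensor_relatorI)
  fix u u' v :: 'a
  show "Poly_Mapping.single (u + u', v) 1 - Poly_Mapping.single (u, v) 1 - Poly_Mapping.single (u', v) 1
          \<in> (tensor_relators :: ('a \<times> 'a \<Rightarrow>\<^sub>0 real) set)"
    unfolding tensor_relators_def by blast
qed (rule diff_diff_eq)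

lemma tensor_add_right: "tensor u (v + v') = tensor u v + tensor u v'"
proof (transfer, rule tensor_relatorI)
  fix u v v' :: 'a
  show "Poly_Mapping.single (u, v + v') 1 - Poly_Mapping.single (u, v) 1 - Poly_Mapping.single (u, v') 1
          \<in> (tensor_relators :: ('a \<times> 'a \<Rightarrow>\<^sub>0 real) set)"
    unfolding tensor_relators_def by blast
qed (rule diff_diff_eq)

lemma tensor_scaleR_left: "tensor (a *\<^sub>R u) v = a *\<^sub>R tensor u v"
proof (transfer, rule tensor_relatorI)
  fix a :: real and u v :: 'a
  show "Poly_Mapping.single (a *\<^sub>R u, v) 1 - a *\<^sub>R Poly_Mapping.single (u, v) 1
          \<in> (tensor_relators :: ('a \<times> 'a \<Rightarrow>\<^sub>0 real) set)"
    unfolding tensor_relators_def by blast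
qed (rule refl)

lemma tensor_scaleR_right: "tensor u (a *\<^sub>R v) = a *\<^sub>R tensor u v"
proof (transfer, rule tensor_relatorI)
  fix a :: real and u v :: 'a
  show "Poly_Mapping.single (u, a *\<^sub>R v) 1 - a *\<^sub>R Poly_Mapping.single (u, v) 1
          \<in> (tensor_relators :: ('a \<times> 'a \<Rightarrow>\<^sub>0 real) set)"
    unfolding tensor_relators_def by blast
qed (rule refl)

definition tensor_norm :: "('v::real_normed_vector tensor_square \<Rightarrow> real) \<Rightarrow> bool" where
  "tensor_norm N \<longleftrightarrow>
     (\<forall>x. N x = 0 \<longleftrightarrow> x = 0) \<and>
     (\<forall>x y. N (x + y) \<le> N x + N y) \<and>
     (\<forall>a x. N (a *\<^sub>R x) = \<bar>a\<bar> * N x) \<and>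
     (\<forall>u v. N (tensor u v) \<le> norm u * norm v)"

text \<open>
  A completion of the tensor square under the norm \<open>N\<close> is given by a Banach space \<open>'e\<close> together
  with a linear isometric embedding \<open>\<iota>\<close> onto a dense subspace.
\<close>

definition tensor_completion ::
  "('v::real_normed_vector tensor_square \<Rightarrow> real) \<Rightarrow> ('v tensor_square \<Rightarrow> 'e::banach) \<Rightarrow> bool" where
  "tensor_completion N \<iota> \<longleftrightarrow>
     linear \<iota> \<and> (\<forall>x. norm (\<iota> x) = N x) \<and> closure (range \<iota>) = UNIV"

definition bracket :: "'v::real_vector \<Rightarrow> 'v \<Rightarrow> 'v tensor_square" where
  "bracket u v = tensor u v - tensor v u"


section \<open>Rough paths indexed by the natural numbers\<close>

text \<open>Only meant for exponents \<open>r > 0\<close>, where \<open>\<infinity>\<close> has the power \<open>\<infinity>\<close>.\<close>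

definition ennreal_powr :: "ennreal \<Rightarrow> real \<Rightarrow> ennreal" where
  "ennreal_powr x r = (if x = \<infinity> then \<infinity> else ennreal (enn2real x powr r))"

text \<open>
  Functions on the triangle \<open>{(i, j). i \<le> j}\<close> are total functions of two arguments here; only
  their values on the triangle matter. The indices \<open>k 0 < \<dots> < k n\<close> of a partition are the values
  on \<open>{..n}\<close> of a function \<open>k\<close>.
\<close>

definition p_variation :: "real \<Rightarrow> (nat \<Rightarrow> nat \<Rightarrow> 'e::real_normed_vector) \<Rightarrow> ennreal" where
  "p_variation p \<alpha> =
     (SUP N\<in>{1..}.
        ennreal_powr
          (SUP (n, k)\<in>{(n :: nat, k :: nat \<Rightarrow> nat). strict_mono_on {..n} k \<and> k n \<le> N}.
             ennreal (\<Sum>j<n. norm (\<alpha> (k j) (k (Suc j))) powr p))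
          (1 / p))"

definition increments :: "(nat \<Rightarrow> 'e::real_vector) \<Rightarrow> nat \<Rightarrow> nat \<Rightarrow> 'e" where
  "increments \<gamma> k1 k2 = \<gamma> k1 - \<gamma> k2"

definition area ::
  "('v::real_vector tensor_square \<Rightarrow> 'e::real_vector) \<Rightarrow> (nat \<Rightarrow> 'v) \<Rightarrow> nat \<Rightarrow> nat \<Rightarrow> 'e" where
  "area \<iota> \<gamma> k1 k2 =
     (if k2 \<ge> k1 + 2
      then (1 / 2) *\<^sub>R (\<Sum>(j1, j2)\<in>{(j1, j2). k1 \<le> j1 \<and> j1 < j2 \<and> j2 \<le> k2 - 1}.
                          \<iota> (bracket (\<gamma> (j1 + 1) - \<gamma> j1) (\<gamma> (j2 + 1) - \<gamma> j2)))
      else 0)"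

definition rough_norm ::
  "(nat \<Rightarrow> 'v::real_normed_vector) \<Rightarrow> (nat \<Rightarrow> nat \<Rightarrow> 'e::real_normed_vector) \<Rightarrow> ennreal" where
  "rough_norm \<gamma> \<alpha> = ennreal_powr ((p_variation 2 (increments \<gamma>))\<^sup>2 + p_variation 1 \<alpha>) (1 / 2)"

definition geometric_rough_path ::
  "('v::real_normed_vector tensor_square \<Rightarrow> 'e::real_normed_vector) \<Rightarrow> (nat \<Rightarrow> 'v) \<Rightarrow> bool" where
  "geometric_rough_path \<iota> \<gamma> \<longleftrightarrow> rough_norm \<gamma> (area \<iota> \<gamma>) < \<infinity>"

definition geometric_rough_process ::
  "('v::real_normed_vector tensor_square \<Rightarrow> 'e::real_normed_vector) \<Rightarrow>
     'a measure \<Rightarrow> ('a \<Rightarrow> nat \<Rightarrow> 'v) \<Rightarrow> bool" where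
  "geometric_rough_process \<iota> M X \<longleftrightarrow> (AE \<omega> in M. geometric_rough_path \<iota> (X \<omega>))"


section \<open>Orthonormal systems\<close>

text \<open>
  The statement \<open>has_bochner_integral\<close> includes the integrability of the inner products, which is
  automatic for \<open>m = n\<close>, and for all \<open>m, n\<close> if \<open>'v\<close> is separable.
\<close>

definition orthonormal_system :: "'a measure \<Rightarrow> (nat \<Rightarrow> 'a \<Rightarrow> 'v::real_inner) \<Rightarrow> bool" where
  "orthonormal_system M u \<longleftrightarrow>
     (\<forall>n. u n \<in> borel_measurable M) \<and>
     (\<forall>n m. has_bochner_integral M (\<lambda>\<omega>. u n \<omega> \<bullet> u m \<omega>) (if m = n then 1 else 0))"

definition partial_sum_process ::
  "(nat \<Rightarrow> real) \<Rightarrow> (nat \<Rightarrow> 'a \<Rightarrow> 'v::real_vector) \<Rightarrow> 'a \<Rightarrow> nat \<Rightarrow> 'v" where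
  "partial_sum_process c u \<omega> n = (\<Sum>k\<le>n. c k *\<^sub>R u k \<omega>)"

end

theory Submission
  imports Defs "HOL-Library.Discrete_Functions"
begin

text \<open>
  The positive part is a pathwise estimate by sums over dyadic intervals. With \<open>N = n + 1\<close>, the
  increments of the partial sum process over intervals \<open>[a, b)\<close> of indices \<open>N\<close> are controlled by
  \<open>\<omega>(a, b) = \<Sum> w\<^sub>D \<parallel>X\<^sub>D\<parallel>\<^sup>2\<close>, summed over the dyadic intervals \<open>D \<subseteq> [a, b)\<close>, where \<open>X\<^sub>D\<close> is the increment over
  \<open>D\<close>. This quantity is superadditive, so the bounds \<open>\<parallel>X\<^sub>J\<parallel>\<^sup>2 \<le> 3 \<omega>(J)\<close> and \<open>\<parallel>A(J)\<parallel> \<le> 2 \<omega>(J)\<close> for single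
  intervals \<open>J\<close> bound the square of the 2-variation of \<open>X\<close> by \<open>3 \<omega>\<close> and the 1-variation of the area by
  \<open>2 \<omega>\<close>, where \<open>\<omega>\<close> is the sum over all dyadic intervals. Both bounds for \<open>J\<close> come from cutting \<open>J\<close> into
  dyadic intervals: a bounded number from each level of the binary tree below a block \<open>[2\<^sup>i, 2\<^sup>i\<^sup>+\<^sup>1)\<close> at each
  end, and whole blocks in between. By the Cauchy-Schwarz inequality the square of the sum of the
  \<open>\<parallel>X\<^sub>D\<parallel>\<close> over these pieces is at most \<open>3 \<omega>(J)\<close> when a node in block \<open>i\<close> has weight about \<open>i\<close> and the
  whole block has weight about \<open>i\<^sup>2\<close> (\<open>dominated_general\<close>). The area needs no estimate of its own: by
  Chen's relation the area of \<open>J\<close> is a sum of brackets of increments over disjoint dyadic intervals, so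
  the same sum of squares dominates it (\<open>area_node\<close>, \<open>dominated_append\<close>). Orthonormality gives
  \<open>\<integral> \<parallel>X\<^sub>D\<parallel>\<^sup>2 = \<Sum> c\<^sub>n\<^sup>2\<close> with \<open>n + 1\<close> running through \<open>D\<close>, and the weights of the dyadic intervals that contain
  \<open>N \<ge> 2\<close> add up to at most \<open>6 (log\<^sub>2 N)\<^sup>2\<close> (\<open>node_weight_sum_le\<close>). The resulting constant is \<open>(3 + 2) * 6 = 30\<close>.

  For the converse, Menshov's idea is realised on the real line with Lebesgue measure by means of the
  kernel \<open>h(i) = 1 / (i + 1/2)\<close>, whose integer translates are orthogonal in \<open>\<ell>\<^sup>2(\<int>)\<close>. The \<open>2\<^sup>q\<close> functions of
  block \<open>q\<close> are these translates, read on cells of length \<open>2\<^sup>-\<^sup>q\<close>. At a point of \<open>[1/2, 1)\<close>, which lies in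
  the \<open>i\<close>-th cell for some \<open>i\<close> with \<open>2\<^sup>q\<^sup>-\<^sup>1 \<le> i < 2\<^sup>q\<close>, the sum of the translates by \<open>0, \<dots>, i\<close> is a harmonic sum
  of order \<open>q\<close>. With equal coefficients \<open>b / sqrt(2\<^sup>q)\<close> in the block, the partial sums therefore have an
  increment of order \<open>b q\<close> at every such point (\<open>menshov_large_increment\<close>), while the block contributes
  only \<open>b\<^sup>2 o(q\<^sup>2)\<close> to the weighted sum of the squares of the coefficients. Selecting blocks sparsely makes the
  weighted sum finite and the increments unbounded. A sign that alternates within each cell makes
  different blocks orthogonal.
\<close>

section \<open>Sums over dyadic intervals\<close>

text \<open>
  The pair \<open>(l, m)\<close> stands for the dyadic interval \<open>[m 2\<^sup>l, (m + 1) 2\<^sup>l)\<close> of level \<open>l\<close>.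
\<close>
definition dyadics :: "nat \<Rightarrow> nat \<Rightarrow> (nat \<times> nat) set" where
  "dyadics a b = {(l, m). a \<le> m * 2 ^ l \<and> (m + 1) * 2 ^ l \<le> b}"

definition dyadic_sum :: "(nat \<Rightarrow> nat \<Rightarrow> real) \<Rightarrow> nat \<Rightarrow> nat \<Rightarrow> real" where
  "dyadic_sum f a b = (\<Sum>(l, m)\<in>dyadics a b. f l m)"

lemma finite_dyadics: "finite (dyadics a b)"
proof (rule finite_subset)
  show "dyadics a b \<subseteq> {..b} \<times> {..b}"
  proof (clarsimp simp: dyadics_def)
    fix l m :: nat
    assume "2 ^ l + m * 2 ^ l \<le> b"
    moreover have "m \<le> m * 2 ^ l" "l < 2 ^ l" by auto
    ultimately show "l \<le> b \<and> m \<le> b" by linarith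
  qed
qed auto

lemma dyadics_mono: "c \<le> a \<Longrightarrow> b \<le> d \<Longrightarrow> dyadics a b \<subseteq> dyadics c d"
  by (auto simp: dyadics_def)

lemma dyadics_disjoint: "dyadics a b \<inter> dyadics b c = {}"
proof -
  have False if "(m + 1) * 2 ^ l \<le> b" "b \<le> m * 2 ^ l" for l m
    using le_trans[OF that] by simp
  then show ?thesis by (auto simp: dyadics_def)
qed

lemma dyadic_node_mem: "(l, m) \<in> dyadics (m * 2 ^ l) ((m + 1) * 2 ^ l)"
  by (simp add: dyadics_def)

lemma dyadic_sum_mono:
  assumes "\<And>l m. 0 \<le> f l m" "c \<le> a" "b \<le> d"
  shows "dyadic_sum f a b \<le> dyadic_sum f c d"
  unfolding dyadic_sum_def using assms
  by (intro sum_mono2 finite_dyadics dyadics_mono) auto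

lemma dyadic_sum_nonneg: "(\<And>l m. 0 \<le> f l m) \<Longrightarrow> 0 \<le> dyadic_sum f a b"
  unfolding dyadic_sum_def by (intro sum_nonneg) auto

lemma dyadic_sum_ge_node:
  assumes "\<And>l m. 0 \<le> f l m"
  shows "f l m \<le> dyadic_sum f (m * 2 ^ l) ((m + 1) * 2 ^ l)"
  unfolding dyadic_sum_def
  using member_le_sum[OF dyadic_node_mem[of l m], of "\<lambda>(l, m). f l m"] assms
  by (auto simp: finite_dyadics)

lemma dyadic_sum_superadd:
  assumes f: "\<And>l m. 0 \<le> f l m" and "a \<le> b" "b \<le> c"
  shows "dyadic_sum f a b + dyadic_sum f b c \<le> dyadic_sum f a c"
proof -
  have "dyadic_sum f a b + dyadic_sum f b c = (\<Sum>(l, m)\<in>dyadics a b \<union> dyadics b c. f l m)"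
    unfolding dyadic_sum_def
    by (rule sum.union_disjoint[symmetric]) (auto simp: finite_dyadics dyadics_disjoint)
  also have "\<dots> \<le> dyadic_sum f a c"
    unfolding dyadic_sum_def using assms
    by (intro sum_mono2) (auto simp: finite_dyadics intro: set_mp[OF dyadics_mono])
  finally show ?thesis .
qed

text \<open>
  The node itself lies in neither part, and so its own term can be added. This spare term drives the
  induction over the tree in \<open>area_node\<close>.
\<close>
lemma dyadic_sum_superadd_node:
  assumes f: "\<And>l m. 0 \<le> f l m" and mid: "m * 2 ^ l < b" "b < (m + 1) * 2 ^ l"
  shows "f l m + dyadic_sum f (m * 2 ^ l) b + dyadic_sum f b ((m + 1) * 2 ^ l)
    \<le> dyadic_sum f (m * 2 ^ l) ((m + 1) * 2 ^ l)"
proof -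
  let ?a = "m * 2 ^ l" and ?c = "(m + 1) * 2 ^ l"
  have "dyadic_sum f ?a b + dyadic_sum f b ?c = (\<Sum>(l, m)\<in>dyadics ?a b \<union> dyadics b ?c. f l m)"
    unfolding dyadic_sum_def
    by (rule sum.union_disjoint[symmetric]) (auto simp: finite_dyadics dyadics_disjoint)
  moreover have "(l, m) \<notin> dyadics ?a b \<union> dyadics b ?c"
    using mid by (auto simp: dyadics_def)
  ultimately have "f l m + dyadic_sum f ?a b + dyadic_sum f b ?c
      = (\<Sum>(l, m)\<in>insert (l, m) (dyadics ?a b \<union> dyadics b ?c). f l m)"
    by (simp add: finite_dyadics)
  also have "\<dots> \<le> dyadic_sum f ?a ?c"
    unfolding dyadic_sum_def using assms
    by (intro sum_mono2 finite_dyadics) (auto simp: dyadics_def)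
  finally show ?thesis .
qed

lemma dyadic_sum_partition:
  assumes f: "\<And>l m. 0 \<le> f l m" and k: "\<And>j. j < n \<Longrightarrow> k j \<le> k (Suc j)"
  shows "(\<Sum>j<n. dyadic_sum f (k j) (k (Suc j))) \<le> dyadic_sum f (k 0) (k n)"
  using k
proof (induction n)
  case 0
  then show ?case by (simp add: dyadic_sum_nonneg f)
next
  case (Suc n)
  note step = Suc.prems
  have "k 0 \<le> k m" if "m \<le> n" for m using that
  proof (induction m)
    case (Suc m)
    then show ?case using le_trans[of "k 0" "k m" "k (Suc m)"] step[of m] by simp
  qed simp
  then have "k 0 \<le> k n" by simp
  moreover have "k n \<le> k (Suc n)" using Suc.prems by simp
  ultimately show ?case
    using Suc.IH Suc.prems dyadic_sum_superadd[of f "k 0" "k n" "k (Suc n)"] f by fastforce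
qed

text \<open>
  The Cauchy-Schwarz inequality in the form in which constants add up when two adjacent intervals are
  joined. Repeated use of it yields the constants \<open>l + 1\<close>, \<open>2\<close> and \<open>3\<close> below.
\<close>
lemma cauchy_schwarz_two:
  fixes r t x y \<alpha> \<beta> :: real
  assumes "r\<^sup>2 \<le> \<alpha> * x" "t\<^sup>2 \<le> \<beta> * y" "0 \<le> \<alpha>" "0 \<le> \<beta>" "0 \<le> x" "0 \<le> y"
  shows "(r + t)\<^sup>2 \<le> (\<alpha> + \<beta>) * (x + y)"
proof -
  have "(r * t)\<^sup>2 \<le> (\<alpha> * x) * (\<beta> * y)"
    unfolding power_mult_distrib using assms by (intro mult_mono) auto
  also have "\<dots> = (\<alpha> * y) * (\<beta> * x)" by simp
  also have "4 * \<dots> \<le> (\<alpha> * y + \<beta> * x)\<^sup>2"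
    using zero_le_power2[of "\<alpha> * y - \<beta> * x"] by (simp add: power2_eq_square algebra_simps)
  finally have "(2 * (r * t))\<^sup>2 \<le> (\<alpha> * y + \<beta> * x)\<^sup>2"
    by (simp add: power_mult_distrib)
  then have "2 * (r * t) \<le> \<alpha> * y + \<beta> * x"
    using assms by (intro power2_le_imp_le[of "2 * (r * t)"]) auto
  then show ?thesis using assms(1,2) by (simp add: power2_sum algebra_simps)
qed

text \<open>
  The intervals \<open>(l, 1)\<close> are the blocks \<open>[2\<^sup>l, 2\<^sup>l\<^sup>+\<^sup>1)\<close>. An interval may run through many of them, and the
  weights \<open>(l + 1)\<^sup>2\<close> keep the Cauchy-Schwarz constant \<open>\<Sum> (l + 1)\<^sup>-\<^sup>2\<close> finite. Inside block \<open>i\<close> a bounded number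
  of nodes from each of \<open>i\<close> levels occurs, for which weights of at least \<open>i + 1\<close> suffice; the logarithm of
  the left end of such a node is at least \<open>i\<close>.
\<close>
definition node_weight :: "nat \<Rightarrow> nat \<Rightarrow> real" where
  "node_weight l m = (if m = 1 then (real l + 1)\<^sup>2 else 1 + log 2 (real (m * 2 ^ l)))"

lemma node_weight_ge_1: "1 \<le> node_weight l m"
proof (cases "m = 0")
  case True
  (* Here the logarithm of 0 takes its default value 0. *)
  then show ?thesis by (simp add: node_weight_def log_def)
next
  case False
  then have "1 \<le> m * 2 ^ l" by simp
  then have "1 \<le> real (m * 2 ^ l)" by (metis of_nat_1 of_nat_mono)
  then have "0 \<le> log 2 (real (m * 2 ^ l))" by (subst zero_le_log_cancel_iff) auto
  then show ?thesis by (simp add: node_weight_def)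
qed

lemma node_weight_nonneg: "0 \<le> node_weight l m"
  using node_weight_ge_1[of l m] by linarith

lemma node_weight_ge:
  assumes "2 ^ i \<le> m * 2 ^ l"
  shows "real i + 1 \<le> node_weight l m"
proof (cases "m = 1")
  case True
  then have "i \<le> l" using assms by simp
  moreover have "real l + 1 \<le> (real l + 1)\<^sup>2" by (simp add: power2_eq_square algebra_simps)
  ultimately show ?thesis using True by (simp add: node_weight_def)
next
  case False
  have "2 ^ i \<le> real (m * 2 ^ l)" using assms by (metis of_nat_le_iff of_nat_numeral of_nat_power)
  then have "log 2 (2 ^ i) \<le> log 2 (real (m * 2 ^ l))"
    by (subst log_le_cancel_iff) (auto intro: less_le_trans[of _ "2 ^ i"])
  then show ?thesis using False by (simp add: node_weight_def)
qed

section \<open>Increments and areas of intervals\<close>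

definition energy :: "(nat \<Rightarrow> nat \<Rightarrow> real) \<Rightarrow> nat \<Rightarrow> nat \<Rightarrow> real" where
  "energy s = dyadic_sum (\<lambda>l m. (s (m * 2 ^ l) ((m + 1) * 2 ^ l))\<^sup>2)"

definition control :: "(nat \<Rightarrow> nat \<Rightarrow> real) \<Rightarrow> nat \<Rightarrow> nat \<Rightarrow> real" where
  "control s = dyadic_sum (\<lambda>l m. node_weight l m * (s (m * 2 ^ l) ((m + 1) * 2 ^ l))\<^sup>2)"

text \<open>
  The number \<open>r\<close> stands for the sum of the increments over the pieces of a dyadic partition of \<open>[a, b)\<close>.
  Half of its square contains the products of increments over distinct pieces, which are the cross
  terms of Chen's relation; the energy pays for the areas of the pieces.
\<close>
definition dominated ::
  "(nat \<Rightarrow> nat \<Rightarrow> real) \<Rightarrow> (nat \<Rightarrow> nat \<Rightarrow> real) \<Rightarrow> nat \<Rightarrow> nat \<Rightarrow> real \<Rightarrow> bool" where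
  "dominated s A a b r \<longleftrightarrow> s a b \<le> r \<and> A a b \<le> r\<^sup>2 / 2 + energy s a b / 2"

lemma energy_nonneg: "0 \<le> energy s a b"
  unfolding energy_def by (intro dyadic_sum_nonneg) simp

lemma control_nonneg: "0 \<le> control s a b"
  unfolding control_def by (intro dyadic_sum_nonneg) (simp add: node_weight_nonneg)

lemma energy_superadd: "a \<le> b \<Longrightarrow> b \<le> c \<Longrightarrow> energy s a b + energy s b c \<le> energy s a c"
  unfolding energy_def by (intro dyadic_sum_superadd) auto

lemma control_superadd: "a \<le> b \<Longrightarrow> b \<le> c \<Longrightarrow> control s a b + control s b c \<le> control s a c"
  unfolding control_def by (intro dyadic_sum_superadd) (auto simp: node_weight_nonneg)

lemma energy_node: "(s (m * 2 ^ l) ((m + 1) * 2 ^ l))\<^sup>2 \<le> energy s (m * 2 ^ l) ((m + 1) * 2 ^ l)"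
  unfolding energy_def
  by (rule dyadic_sum_ge_node[of "\<lambda>l m. (s (m * 2 ^ l) ((m + 1) * 2 ^ l))\<^sup>2"]) auto

lemma control_root: "(real i + 1)\<^sup>2 * (s (2 ^ i) (2 ^ Suc i))\<^sup>2 \<le> control s (2 ^ i) (2 ^ Suc i)"
proof -
  have "node_weight i 1 * (s (1 * 2 ^ i) ((1 + 1) * 2 ^ i))\<^sup>2
      \<le> control s (1 * 2 ^ i) ((1 + 1) * 2 ^ i)"
    unfolding control_def
    by (rule dyadic_sum_ge_node[of "\<lambda>l m. node_weight l m * (s (m * 2 ^ l) ((m + 1) * 2 ^ l))\<^sup>2"])
       (auto simp: node_weight_nonneg)
  then show ?thesis by (simp add: node_weight_def flip: mult_2)
qed

lemma energy_le_control:
  assumes "2 ^ i \<le> a"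
  shows "(real i + 1) * energy s a b \<le> control s a b"
proof -
  have "real i + 1 \<le> node_weight l m" if "(l, m) \<in> dyadics a b" for l m
    using that assms by (intro node_weight_ge) (auto simp: dyadics_def)
  then show ?thesis
    unfolding energy_def control_def dyadic_sum_def sum_distrib_left
    by (intro sum_mono) (auto intro!: mult_right_mono)
qed

text \<open>
  The norms \<open>s\<close> of the increments and \<open>A\<close> of the area enter through the triangle inequality, through
  Chen's relation, and through the vanishing of the area over a single step.
\<close>
context
  fixes s A :: "nat \<Rightarrow> nat \<Rightarrow> real"
  assumes s_nonneg: "0 \<le> s a b"
    and s_triangle: "a \<le> b \<Longrightarrow> b \<le> c \<Longrightarrow> s a c \<le> s a b + s b c"
    and s_same: "s a a = 0"
    and A_chen: "a \<le> b \<Longrightarrow> b \<le> c \<Longrightarrow> A a c \<le> A a b + A b c + s a b * s b c"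
    and A_same: "A a a = 0" and A_step: "A a (Suc a) = 0"
begin

text \<open>
  Halving a node \<open>[a, c)\<close> at \<open>b\<close> creates the cross term \<open>s a b * s b c\<close>, which is at most half the sum of the
  squares of the increments over the two halves. This is exactly what the subtracted squares in the
  induction hypothesis leave over, and subtracting the square for \<open>[a, c)\<close> is paid for by the term of that
  node in the energy.
\<close>
lemma area_node:
  "A (m * 2 ^ l) ((m + 1) * 2 ^ l)
    \<le> (energy s (m * 2 ^ l) ((m + 1) * 2 ^ l) - (s (m * 2 ^ l) ((m + 1) * 2 ^ l))\<^sup>2) / 2"
proof (induction l arbitrary: m)
  case 0
  then show ?case using energy_node[of s m 0] A_step[of m] by simp
next
  case (Suc l)
  define a b c where "a = m * 2 ^ Suc l" and "b = (2 * m + 1) * 2 ^ l" and "c = (m + 1) * 2 ^ Suc l"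
  have a': "2 * m * 2 ^ l = a" and c': "(2 * m + 1 + 1) * 2 ^ l = c"
    by (simp_all add: a_def c_def algebra_simps)
  have abc: "a < b" "b < c" by (simp_all add: a_def b_def c_def algebra_simps)
  have "A a c \<le> A a b + A b c + s a b * s b c"
    using abc by (intro A_chen) auto
  moreover have "2 * (s a b * s b c) \<le> (s a b)\<^sup>2 + (s b c)\<^sup>2"
    using sum_squares_bound[of "s a b" "s b c"] by simp
  moreover have "A a b \<le> (energy s a b - (s a b)\<^sup>2) / 2"
    using Suc.IH[of "2 * m"] unfolding a' b_def by simp
  moreover have "A b c \<le> (energy s b c - (s b c)\<^sup>2) / 2"
    using Suc.IH[of "2 * m + 1"] unfolding c' b_def[symmetric] by simp
  moreover have "(s a c)\<^sup>2 + energy s a b + energy s b c \<le> energy s a c"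
    using dyadic_sum_superadd_node[of "\<lambda>l m. (s (m * 2 ^ l) ((m + 1) * 2 ^ l))\<^sup>2" m "Suc l" b] abc
    unfolding energy_def a_def[symmetric] c_def[symmetric] by simp
  moreover have "y \<le> (e - p) / 2"
    if "y \<le> y1 + y2 + x" "2 * x \<le> p1 + p2" "y1 \<le> (e1 - p1) / 2" "y2 \<le> (e2 - p2) / 2"
      "p + e1 + e2 \<le> e" for e e1 e2 p p1 p2 x y y1 y2 :: real
    using that by (simp add: field_simps)
  ultimately show ?case unfolding a_def[symmetric] c_def[symmetric] by blast
qed

lemma dominated_empty: "dominated s A a a 0"
  by (simp add: dominated_def s_same A_same energy_nonneg)

lemma dominated_node:
  "dominated s A (m * 2 ^ l) ((m + 1) * 2 ^ l) (s (m * 2 ^ l) ((m + 1) * 2 ^ l))"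
  using area_node[of m l] zero_le_power2[of "s (m * 2 ^ l) ((m + 1) * 2 ^ l)"]
  unfolding dominated_def diff_divide_distrib by linarith

text \<open>
  The cross term of Chen's relation is absorbed by the mixed term of \<open>(r + t)\<^sup>2 / 2\<close>.
\<close>
lemma dominated_append:
  assumes "dominated s A a b r" "dominated s A b c t" "a \<le> b" "b \<le> c"
  shows "dominated s A a c (r + t)"
proof -
  have "0 \<le> r" "s a b \<le> r" "s b c \<le> t"
    using assms s_nonneg[of a b] by (auto simp: dominated_def)
  then have "s a b * s b c \<le> r * t" by (intro mult_mono s_nonneg) auto
  with assms s_triangle[of a b c] A_chen[of a b c] energy_superadd[of a b c s]
  show ?thesis unfolding dominated_def power2_sum by (auto simp: field_simps)
qed

text \<open>
  Descending the tree, a suffix of a node is a suffix of its right half, or the whole right half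
  preceded by a suffix of the left half. Each step of the descent thus adds at most one piece, and \<open>1\<close> to
  the Cauchy-Schwarz constant.
\<close>
lemma dominated_suffix:
  assumes "m * 2 ^ l \<le> a" "a \<le> (m + 1) * 2 ^ l"
  shows "\<exists>r. dominated s A a ((m + 1) * 2 ^ l) r \<and> r\<^sup>2 \<le> (real l + 1) * energy s a ((m + 1) * 2 ^ l)"
  using assms
proof (induction l arbitrary: m)
  case 0
  then consider "a = m" | "a = m + 1" by force
  then show ?case
  proof cases
    case 1
    then show ?thesis using dominated_node[of m 0] energy_node[of s m 0] by auto
  next
    case 2
    then show ?thesis using dominated_empty[of a] energy_nonneg[of s a a] by auto
  qed
next
  case (Suc l)
  define b c where "b = (2 * m + 1) * 2 ^ l" and "c = (m + 1) * 2 ^ Suc l"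
  have c': "(2 * m + 1 + 1) * 2 ^ l = c" by (simp add: c_def)
  show ?case
  proof (cases "b \<le> a")
    case True
    then obtain r where "dominated s A a c r" "r\<^sup>2 \<le> (real l + 1) * energy s a c"
      using Suc.IH[of "2 * m + 1"] Suc.prems unfolding c' b_def c_def by auto
    then show ?thesis unfolding c_def[symmetric] using energy_nonneg[of s a c]
      by (intro exI[of _ r]) (auto simp: algebra_simps)
  next
    case False
    then obtain r where r: "dominated s A a b r" "r\<^sup>2 \<le> (real l + 1) * energy s a b"
      using Suc.IH[of "2 * m"] Suc.prems unfolding b_def by (auto simp: algebra_simps)
    have t: "dominated s A b c (s b c)" "(s b c)\<^sup>2 \<le> 1 * energy s b c"
      using dominated_node[of "2 * m + 1" l] energy_node[of s "2 * m + 1" l]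
      unfolding c' b_def[symmetric] by simp_all
    have "b \<le> c" unfolding b_def c_def by (simp add: algebra_simps)
    then have "energy s a b + energy s b c \<le> energy s a c" "dominated s A a c (r + s b c)"
      using False r t by (auto intro: energy_superadd dominated_append)
    moreover have "(r + s b c)\<^sup>2 \<le> (real l + 1 + 1) * (energy s a b + energy s b c)"
      using r t by (intro cauchy_schwarz_two) (auto simp: energy_nonneg)
    moreover have "(real l + 1 + 1) * (energy s a b + energy s b c) \<le> (real l + 1 + 1) * energy s a c"
      using calculation by (intro mult_left_mono) auto
    ultimately have "dominated s A a c (r + s b c)" "(r + s b c)\<^sup>2 \<le> (real l + 1 + 1) * energy s a c"
      by linarith+
    then show ?thesis unfolding c_def[symmetric]
      by (intro exI[of _ "r + s b c"]) (auto simp: add_ac)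
  qed
qed

lemma dominated_prefix:
  assumes "m * 2 ^ l \<le> b" "b \<le> (m + 1) * 2 ^ l"
  shows "\<exists>r. dominated s A (m * 2 ^ l) b r \<and> r\<^sup>2 \<le> (real l + 1) * energy s (m * 2 ^ l) b"
  using assms
proof (induction l arbitrary: m)
  case 0
  then consider "b = m" | "b = m + 1" by force
  then show ?case
  proof cases
    case 1
    then show ?thesis using dominated_empty[of b] energy_nonneg[of s b b] by auto
  next
    case 2
    then show ?thesis using dominated_node[of m 0] energy_node[of s m 0] by auto
  qed
next
  case (Suc l)
  define c a where "c = (2 * m + 1) * 2 ^ l" and "a = m * 2 ^ Suc l"
  have a': "2 * m * 2 ^ l = a" by (simp add: a_def)
  show ?case
  proof (cases "b \<le> c")
    case True
    then obtain r where "dominated s A a b r" "r\<^sup>2 \<le> (real l + 1) * energy s a b"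
      using Suc.IH[of "2 * m"] Suc.prems unfolding a' c_def a_def by auto
    then show ?thesis unfolding a_def[symmetric] using energy_nonneg[of s a b]
      by (intro exI[of _ r]) (auto simp: algebra_simps)
  next
    case False
    then obtain r where r: "dominated s A c b r" "r\<^sup>2 \<le> (real l + 1) * energy s c b"
      using Suc.IH[of "2 * m + 1"] Suc.prems unfolding c_def by (auto simp: algebra_simps)
    have t: "dominated s A a c (s a c)" "(s a c)\<^sup>2 \<le> 1 * energy s a c"
      using dominated_node[of "2 * m" l] energy_node[of s "2 * m" l]
      unfolding a' c_def[symmetric] by simp_all
    have "a \<le> c" unfolding a_def c_def by (simp add: algebra_simps)
    then have "energy s a c + energy s c b \<le> energy s a b" "dominated s A a b (s a c + r)"
      using False r t by (auto intro: energy_superadd dominated_append)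
    moreover have "(s a c + r)\<^sup>2 \<le> (1 + (real l + 1)) * (energy s a c + energy s c b)"
      using r t by (intro cauchy_schwarz_two) (auto simp: energy_nonneg)
    moreover have "(1 + (real l + 1)) * (energy s a c + energy s c b) \<le> (1 + (real l + 1)) * energy s a b"
      using calculation by (intro mult_left_mono) auto
    ultimately have "dominated s A a b (s a c + r)" "(s a c + r)\<^sup>2 \<le> (1 + (real l + 1)) * energy s a b"
      by linarith+
    then show ?thesis unfolding a_def[symmetric]
      by (intro exI[of _ "s a c + r"]) (auto simp: add_ac)
  qed
qed

text \<open>
  An interval inside a node is a suffix followed by a prefix, below the last node that contains it.
\<close>
lemma dominated_inside:
  assumes "m * 2 ^ l \<le> a" "a \<le> b" "b \<le> (m + 1) * 2 ^ l"
  shows "\<exists>r. dominated s A a b r \<and> r\<^sup>2 \<le> 2 * (real l + 1) * energy s a b"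
  using assms
proof (induction l arbitrary: m)
  case 0
  then consider "a = b" | "a = m" "b = m + 1" by force
  then show ?case
  proof cases
    case 1
    then show ?thesis using dominated_empty[of a] energy_nonneg[of s a b] by auto
  next
    case 2
    then show ?thesis using dominated_node[of m 0] energy_node[of s m 0] energy_nonneg[of s a b]
      by (intro exI[of _ "s a b"]) (auto intro: order_trans[of _ "energy s m (Suc m)"])
  qed
next
  case (Suc l)
  define c where "c = (2 * m + 1) * 2 ^ l"
  have weaken: ?case if "\<exists>r. dominated s A a b r \<and> r\<^sup>2 \<le> 2 * (real l + 1) * energy s a b"
    using that energy_nonneg[of s a b] by (force simp: algebra_simps)
  consider "b \<le> c" | "c \<le> a" | "a \<le> c" "c \<le> b" by linarith
  then show ?case
  proof cases
    case 1
    show ?thesis by (rule weaken, rule Suc.IH[of "2 * m"]) (use 1 Suc.prems c_def in auto)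
  next
    case 2
    show ?thesis by (rule weaken, rule Suc.IH[of "2 * m + 1"]) (use 2 Suc.prems c_def in auto)
  next
    case 3
    obtain r where r: "dominated s A a c r" "r\<^sup>2 \<le> (real l + 1) * energy s a c"
      using dominated_suffix[of "2 * m" l a] 3 Suc.prems by (auto simp: c_def)
    obtain t where t: "dominated s A c b t" "t\<^sup>2 \<le> (real l + 1) * energy s c b"
      using dominated_prefix[of "2 * m + 1" l b] 3 Suc.prems by (auto simp: c_def)
    have "(r + t)\<^sup>2 \<le> ((real l + 1) + (real l + 1)) * (energy s a c + energy s c b)"
      using r t by (intro cauchy_schwarz_two) (auto simp: energy_nonneg)
    also have "\<dots> \<le> ((real l + 1) + (real l + 1)) * energy s a b"
      using 3 by (intro mult_left_mono energy_superadd) auto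
    finally show ?thesis
      using dominated_append[OF r(1) t(1) 3] by (intro weaken exI[of _ "r + t"]) (auto simp: algebra_simps)
  qed
qed

text \<open>
  An interval that ends at a power of two is a suffix of one block followed by whole blocks. Appending
  block \<open>i + 1\<close> increases the constant by \<open>1 / (i + 1) - 1 / (i + 2)\<close>, at least the reciprocal of the weight
  \<open>(i + 2)\<^sup>2\<close> of that block, and so the constants stay below \<open>2\<close>.
\<close>
lemma dominated_to_power:
  assumes "2 \<le> a" "a \<le> 2 ^ Suc i"
  shows "\<exists>r. dominated s A a (2 ^ Suc i) r \<and> r\<^sup>2 \<le> (2 - 1 / (real i + 1)) * control s a (2 ^ Suc i)"
  using assms
proof (induction i)
  case 0
  then have "a = 2" by simp
  then show ?case using dominated_empty[of 2] control_nonneg[of s 2 2] by auto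
next
  case (Suc i)
  let ?b = "2 ^ Suc i :: nat" and ?c = "2 ^ Suc (Suc i) :: nat"
  show ?case
  proof (cases "?b \<le> a")
    case True
    then obtain r where r: "dominated s A a ?c r" "r\<^sup>2 \<le> (real (Suc i) + 1) * energy s a ?c"
      using dominated_suffix[of 1 "Suc i" a] Suc.prems by auto
    note r(2)
    also have "(real (Suc i) + 1) * energy s a ?c \<le> 1 * control s a ?c"
      using energy_le_control[OF True] by simp
    also have "\<dots> \<le> (2 - 1 / (real (Suc i) + 1)) * control s a ?c"
      by (intro mult_right_mono control_nonneg) (simp add: field_simps)
    finally show ?thesis using r(1) by blast
  next
    case False
    then obtain r where r: "dominated s A a ?b r" "r\<^sup>2 \<le> (2 - 1 / (real i + 1)) * control s a ?b"
      using Suc by auto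
    define j where "j = real i + 1"
    have j: "0 < j" "j * (j + 1) \<le> (j + 1)\<^sup>2"
      by (simp_all add: j_def power2_eq_square)
    have "j * (j + 1) * (s ?b ?c)\<^sup>2 \<le> control s ?b ?c"
      using control_root[of "Suc i" s] mult_right_mono[OF j(2), of "(s ?b ?c)\<^sup>2"]
      by (auto simp: j_def add_ac)
    then have "(s ?b ?c)\<^sup>2 \<le> 1 / (j * (j + 1)) * control s ?b ?c"
      using mult_pos_pos[OF j(1), of "j + 1"] j(1)
      by (simp add: pos_le_divide_eq mult.commute)
    also have "1 / (j * (j + 1)) = 1 / j - 1 / (j + 1)" using j by (simp add: field_simps)
    finally have t: "(s ?b ?c)\<^sup>2 \<le> (1 / j - 1 / (j + 1)) * control s ?b ?c" .
    have j': "1 / j \<le> 1" "1 / (j + 1) \<le> 1 / j" by (auto simp: j_def field_simps)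
    have "(r + s ?b ?c)\<^sup>2 \<le> ((2 - 1 / j) + (1 / j - 1 / (j + 1))) * (control s a ?b + control s ?b ?c)"
      using r(2) t j' unfolding j_def[symmetric] by (intro cauchy_schwarz_two control_nonneg) linarith+
    also have "\<dots> \<le> (2 - 1 / (j + 1)) * control s a ?c"
      using False control_superadd[of a ?b ?c s] j' by (auto intro!: mult_left_mono)
    finally have "(r + s ?b ?c)\<^sup>2 \<le> (2 - 1 / (real (Suc i) + 1)) * control s a ?c"
      by (simp add: j_def add_ac)
    moreover have "dominated s A a ?c (r + s ?b ?c)"
      using False r(1) dominated_node[of 1 "Suc i"] by (intro dominated_append[of a ?b]) auto
    ultimately show ?thesis by blast
  qed
qed

text \<open>
  If \<open>[a, b)\<close> is not contained in one block, it is cut at the last power of two up to \<open>b\<close>; the two parts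
  contribute the constants \<open>2\<close> and \<open>1\<close>.
\<close>
lemma dominated_general:
  assumes "2 \<le> a" "a \<le> b"
  shows "\<exists>r. dominated s A a b r \<and> r\<^sup>2 \<le> 3 * control s a b"
proof -
  obtain i where i: "2 ^ Suc i \<le> b" "b \<le> 2 ^ Suc (Suc i)"
  proof -
    have "floor_log b \<noteq> 0" using assms floor_log_rec[of b] by simp
    then show thesis
      using that[of "floor_log b - 1"] floor_log_exp2_le[of b] floor_log_exp2_gt[of b] assms by auto
  qed
  show ?thesis
  proof (cases "2 ^ Suc i \<le> a")
    case True
    then obtain r where r: "dominated s A a b r" "r\<^sup>2 \<le> 2 * ((real (Suc i) + 1) * energy s a b)"
      using dominated_inside[of 1 "Suc i" a b] assms i by (auto simp: algebra_simps)
    with energy_le_control[OF True, of s b] control_nonneg[of s a b]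
    show ?thesis by (intro exI[of _ r]) linarith
  next
    case False
    let ?c = "2 ^ Suc i :: nat"
    obtain r where r: "dominated s A a ?c r" "r\<^sup>2 \<le> (2 - 1 / (real i + 1)) * control s a ?c"
      using dominated_to_power[of a i] False assms by auto
    have "(2 - 1 / (real i + 1)) * control s a ?c \<le> 2 * control s a ?c"
      by (intro mult_right_mono control_nonneg) simp
    with r(2) have r2: "r\<^sup>2 \<le> 2 * control s a ?c" by linarith
    obtain t where t: "dominated s A ?c b t" "t\<^sup>2 \<le> (real (Suc i) + 1) * energy s ?c b"
      using dominated_prefix[of 1 "Suc i" b] i by auto
    have t2: "t\<^sup>2 \<le> 1 * control s ?c b"
      using t(2) energy_le_control[of "Suc i" ?c s b] by simp
    have "(r + t)\<^sup>2 \<le> (2 + 1) * (control s a ?c + control s ?c b)"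
      using r2 t2 by (intro cauchy_schwarz_two) (auto simp: control_nonneg)
    moreover have "control s a ?c + control s ?c b \<le> control s a b"
      using False i by (intro control_superadd) auto
    ultimately have "(r + t)\<^sup>2 \<le> 3 * control s a b" by (simp add: algebra_simps)
    then show ?thesis using dominated_append[OF r(1) t(1)] False i by auto
  qed
qed

text \<open>
  The constant for the area is \<open>3 / 2 + 1 / 2\<close>: half of \<open>r\<^sup>2 \<le> 3 * control\<close> and half of the energy, which is at most
  the control.
\<close>
lemma increment_area_control:
  assumes "2 \<le> a" "a \<le> b"
  shows "(s a b)\<^sup>2 \<le> 3 * control s a b" "A a b \<le> 2 * control s a b"
proof -
  obtain r where r: "dominated s A a b r" "r\<^sup>2 \<le> 3 * control s a b"
    using dominated_general[OF assms] by blast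
  have "energy s a b \<le> control s a b"
    using energy_le_control[of 0 a s b] assms by simp
  with r show "A a b \<le> 2 * control s a b" by (simp add: dominated_def field_simps)
  have "(s a b)\<^sup>2 \<le> r\<^sup>2" using r(1) s_nonneg[of a b] by (intro power_mono) (auto simp: dominated_def)
  with r(2) show "(s a b)\<^sup>2 \<le> 3 * control s a b" by linarith
qed

end

section \<open>The pathwise bound of the rough norm\<close>

lemma bracket_add_left: "bracket (u + u') v = bracket u v + bracket u' v"
  by (simp add: bracket_def tensor_add_left tensor_add_right)

lemma bracket_add_right: "bracket u (v + v') = bracket u v + bracket u v'"
  by (simp add: bracket_def tensor_add_left tensor_add_right)

lemma bracket_zero_left: "bracket 0 v = 0"
  using bracket_add_left[of 0 0 v] by simp

lemma bracket_sum_left: "bracket (\<Sum>j\<in>J. f j) v = (\<Sum>j\<in>J. bracket (f j) v)"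
  by (induction J rule: infinite_finite_induct) (simp_all add: bracket_zero_left bracket_add_left)

lemma norm_bracket_le:
  assumes "tensor_norm N" "tensor_completion N \<iota>"
  shows "norm ((1 / 2) *\<^sub>R \<iota> (bracket u v)) \<le> norm u * norm v"
proof -
  note N = assms(1)[unfolded tensor_norm_def]
  have "N (bracket u v) \<le> N (tensor u v) + N ((- 1) *\<^sub>R tensor v u)"
    using N by (metis bracket_def scaleR_minus1_left diff_conv_add_uminus)
  also have "N ((- 1) *\<^sub>R tensor v u) = N (tensor v u)"
    using N by (metis abs_minus abs_one mult_1)
  also have "N (tensor u v) + N (tensor v u) \<le> norm u * norm v + norm v * norm u"
    using N by (intro add_mono) auto
  finally show ?thesis
    using assms(2) by (simp add: tensor_completion_def)
qed

lemma area_eq_sum: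
  "area \<iota> \<gamma> k1 k2 = (1 / 2) *\<^sub>R (\<Sum>(j1, j2)\<in>{(j1, j2). k1 \<le> j1 \<and> j1 < j2 \<and> j2 < k2}.
      \<iota> (bracket (\<gamma> (j1 + 1) - \<gamma> j1) (\<gamma> (j2 + 1) - \<gamma> j2)))"
proof (cases "k1 + 2 \<le> k2")
  case True
  then have "{(j1, j2). k1 \<le> j1 \<and> j1 < j2 \<and> j2 \<le> k2 - 1} = {(j1, j2). k1 \<le> j1 \<and> j1 < j2 \<and> j2 < k2}"
    by auto
  with True show ?thesis by (simp add: area_def)
next
  case False
  then have empty: "{(j1, j2). k1 \<le> j1 \<and> j1 < j2 \<and> j2 < k2} = {}" by auto
  show ?thesis unfolding empty using False by (simp add: area_def)
qed

text \<open>
  The terms of the area with last index \<open>k\<close> add up to a single bracket, because the increments before \<open>k\<close>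
  telescope in its first argument.
\<close>
lemma area_Suc:
  assumes "linear \<iota>" "k1 \<le> k"
  shows "area \<iota> \<gamma> k1 (Suc k)
    = area \<iota> \<gamma> k1 k + (1 / 2) *\<^sub>R \<iota> (bracket (\<gamma> k - \<gamma> k1) (\<gamma> (Suc k) - \<gamma> k))"
proof -
  let ?T = "\<lambda>k. {(j1, j2). k1 \<le> j1 \<and> j1 < j2 \<and> j2 < (k::nat)}"
  let ?g = "\<lambda>j1 j2. \<iota> (bracket (\<gamma> (j1 + 1) - \<gamma> j1) (\<gamma> (j2 + 1) - \<gamma> j2))"
  have T: "?T (Suc k) = ?T k \<union> (\<lambda>j. (j, k)) ` {k1..<k}" by auto
  have fin: "finite (?T k)" by (rule finite_subset[of _ "{..k} \<times> {..k}"]) auto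
  have "(\<Sum>(j1, j2)\<in>?T (Suc k). ?g j1 j2)
      = (\<Sum>(j1, j2)\<in>?T k. ?g j1 j2) + (\<Sum>(j1, j2)\<in>(\<lambda>j. (j, k)) ` {k1..<k}. ?g j1 j2)"
    unfolding T using fin by (intro sum.union_disjoint) auto
  also have "(\<Sum>(j1, j2)\<in>(\<lambda>j. (j, k)) ` {k1..<k}. ?g j1 j2) = (\<Sum>j=k1..<k. ?g j k)"
    by (subst sum.reindex) (auto simp: inj_on_def)
  also have "\<dots> = \<iota> (bracket (\<Sum>j=k1..<k. \<gamma> (j + 1) - \<gamma> j) (\<gamma> (k + 1) - \<gamma> k))"
    by (simp add: bracket_sum_left linear_sum[OF assms(1)])
  also have "(\<Sum>j=k1..<k. \<gamma> (j + 1) - \<gamma> j) = \<gamma> k - \<gamma> k1"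
    using sum_Suc_diff'[OF assms(2), of \<gamma>] by simp
  finally show ?thesis
    unfolding area_eq_sum by (simp add: scaleR_add_right)
qed

lemma area_empty: "area \<iota> \<gamma> k k = 0" and area_single: "area \<iota> \<gamma> k (Suc k) = 0"
  by (simp_all add: area_def)

lemma area_chen:
  assumes \<iota>: "linear \<iota>" and "k1 \<le> k2" "k2 \<le> k3"
  shows "area \<iota> \<gamma> k1 k3
    = area \<iota> \<gamma> k1 k2 + area \<iota> \<gamma> k2 k3 + (1 / 2) *\<^sub>R \<iota> (bracket (\<gamma> k2 - \<gamma> k1) (\<gamma> k3 - \<gamma> k2))"
  using assms(3)
proof (induction k3 rule: dec_induct)
  case base
  have "bracket (\<gamma> k2 - \<gamma> k1) 0 = 0"
    using bracket_add_right[of "\<gamma> k2 - \<gamma> k1" 0 0] by simp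
  then show ?case by (simp add: area_empty linear_0[OF \<iota>])
next
  case (step k)
  let ?D = "\<gamma> (Suc k) - \<gamma> k"
  have "bracket (\<gamma> k2 - \<gamma> k1) (\<gamma> k - \<gamma> k2) + bracket (\<gamma> k - \<gamma> k1) ?D
      = bracket (\<gamma> k2 - \<gamma> k1) (\<gamma> (Suc k) - \<gamma> k2) + bracket (\<gamma> k - \<gamma> k2) ?D"
    using bracket_add_left[of "\<gamma> k2 - \<gamma> k1" "\<gamma> k - \<gamma> k2" ?D]
      bracket_add_right[of "\<gamma> k2 - \<gamma> k1" "\<gamma> k - \<gamma> k2" ?D] by simp
  then have "\<iota> (bracket (\<gamma> k2 - \<gamma> k1) (\<gamma> k - \<gamma> k2)) + \<iota> (bracket (\<gamma> k - \<gamma> k1) ?D)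
      = \<iota> (bracket (\<gamma> k2 - \<gamma> k1) (\<gamma> (Suc k) - \<gamma> k2)) + \<iota> (bracket (\<gamma> k - \<gamma> k2) ?D)"
    by (metis linear_add[OF \<iota>])
  then have "(1/2) *\<^sub>R \<iota> (bracket (\<gamma> k2 - \<gamma> k1) (\<gamma> k - \<gamma> k2)) + (1/2) *\<^sub>R \<iota> (bracket (\<gamma> k - \<gamma> k1) ?D)
      = (1/2) *\<^sub>R \<iota> (bracket (\<gamma> k2 - \<gamma> k1) (\<gamma> (Suc k) - \<gamma> k2)) + (1/2) *\<^sub>R \<iota> (bracket (\<gamma> k - \<gamma> k2) ?D)"
    by (metis scaleR_add_right)
  then show ?case
    using step assms(2) by (simp add: area_Suc[OF \<iota>] algebra_simps)
qed

text \<open>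
  The step from \<open>n\<close> to \<open>n + 1\<close> of the path carries the index \<open>n + 2\<close>. For a partial sum process this step is
  \<open>c\<^bsub>n + 1\<^esub> u\<^bsub>n + 1\<^esub>\<close>, with weight \<open>(log (n + 2))\<^sup>2\<close>, so that the logarithm is taken of the index itself.
\<close>
definition path_increment :: "(nat \<Rightarrow> 'v::real_normed_vector) \<Rightarrow> nat \<Rightarrow> nat \<Rightarrow> real" where
  "path_increment \<gamma> a b = norm (\<gamma> (b - 2) - \<gamma> (a - 2))"

lemma path_control:
  fixes \<gamma> :: "nat \<Rightarrow> 'v::{real_inner, banach}" and \<iota> :: "'v tensor_square \<Rightarrow> 'e::banach"
  assumes N: "tensor_norm N" "tensor_completion N \<iota>" and "k1 \<le> k2"
  shows "(norm (\<gamma> k2 - \<gamma> k1))\<^sup>2 \<le> 3 * control (path_increment \<gamma>) (k1 + 2) (k2 + 2)"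
    and "norm (area \<iota> \<gamma> k1 k2) \<le> 2 * control (path_increment \<gamma>) (k1 + 2) (k2 + 2)"
proof -
  define A where "A a b = norm (area \<iota> \<gamma> (a - 2) (b - 2))" for a b
  have lin: "linear \<iota>" using N(2) by (simp add: tensor_completion_def)
  have tri: "path_increment \<gamma> a c \<le> path_increment \<gamma> a b + path_increment \<gamma> b c" for a b c
    unfolding path_increment_def
    by (rule order_trans[OF _ norm_triangle_ineq]) (simp add: add.commute)
  have chen: "A a c \<le> A a b + A b c + path_increment \<gamma> a b * path_increment \<gamma> b c"
    if "a \<le> b" "b \<le> c" for a b c
  proof -
    have "A a c \<le> norm (area \<iota> \<gamma> (a - 2) (b - 2) + area \<iota> \<gamma> (b - 2) (c - 2))
        + norm ((1 / 2) *\<^sub>R \<iota> (bracket (\<gamma> (b - 2) - \<gamma> (a - 2)) (\<gamma> (c - 2) - \<gamma> (b - 2))))"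
      unfolding A_def using that
      by (subst area_chen[OF lin, of "a - 2" "b - 2"]) (auto simp del: norm_scaleR intro: norm_triangle_ineq)
    also have "\<dots> \<le> (A a b + A b c) + path_increment \<gamma> a b * path_increment \<gamma> b c"
      unfolding A_def path_increment_def by (intro add_mono norm_triangle_ineq norm_bracket_le[OF N])
    finally show ?thesis .
  qed
  have step: "A a (Suc a) = 0" for a
    unfolding A_def by (cases "2 \<le> a") (auto simp: Suc_diff_le area_single area_def)
  note bounds = increment_area_control[of "path_increment \<gamma>" A, OF _ tri _ chen _ step,
      of "k1 + 2" "k2 + 2"]
  show "(norm (\<gamma> k2 - \<gamma> k1))\<^sup>2 \<le> 3 * control (path_increment \<gamma>) (k1 + 2) (k2 + 2)"
    using bounds(1) assms(3) by (simp add: path_increment_def A_def area_empty)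
  show "norm (area \<iota> \<gamma> k1 k2) \<le> 2 * control (path_increment \<gamma>) (k1 + 2) (k2 + 2)"
    using bounds(2) assms(3) by (simp add: path_increment_def A_def area_empty)
qed

lemma ennreal_powr_mono: "x \<le> y \<Longrightarrow> 0 \<le> r \<Longrightarrow> ennreal_powr x r \<le> ennreal_powr y r"
  unfolding ennreal_powr_def
  by (auto simp: top_unique less_top intro!: ennreal_leI powr_mono2 enn2real_mono)

lemma ennreal_powr_1: "ennreal_powr x 1 = x"
  by (simp add: ennreal_powr_def less_top)

lemma ennreal_powr_half_power2: "(ennreal_powr x (1 / 2))\<^sup>2 = x"
  by (simp add: ennreal_powr_def less_top powr_half_sqrt ennreal_power flip: top.not_eq_extremum)

lemma p_variation_le:
  assumes "1 \<le> p"
    and "\<And>n k. strict_mono_on {..n} k \<Longrightarrow>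
      ennreal (\<Sum>j<n. norm (\<alpha> (k j) (k (Suc j))) powr p) \<le> C"
  shows "p_variation p \<alpha> \<le> ennreal_powr C (1 / p)"
  unfolding p_variation_def using assms
  by (intro SUP_least ennreal_powr_mono) auto

text \<open>
  The control is superadditive, hence the sum over any partition is bounded by its value on the whole
  interval.
\<close>
lemma rough_norm_power2_le:
  fixes \<gamma> :: "nat \<Rightarrow> 'v::{real_inner, banach}" and \<iota> :: "'v tensor_square \<Rightarrow> 'e::banach"
  assumes N: "tensor_norm N" "tensor_completion N \<iota>"
  defines "T \<equiv> (SUP n. ennreal (control (path_increment \<gamma>) 2 n))"
  shows "(rough_norm \<gamma> (area \<iota> \<gamma>))\<^sup>2 \<le> 5 * T"
proof -
  let ?c = "control (path_increment \<gamma>)"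
  have part: "ennreal (\<Sum>j<n. g j) \<le> ennreal C * T"
    if k: "strict_mono_on {..n} k" and "0 \<le> C"
      and g: "\<And>j. j < n \<Longrightarrow> k j \<le> k (Suc j) \<Longrightarrow> g j \<le> C * ?c (k j + 2) (k (Suc j) + 2)"
    for n k g and C :: real
  proof -
    have le: "k j \<le> k (Suc j)" if "j < n" for j
      using that k by (intro less_imp_le) (auto simp: strict_mono_on_def)
    have nn: "0 \<le> node_weight l m * (path_increment \<gamma> (m * 2 ^ l) ((m + 1) * 2 ^ l))\<^sup>2" for l m
      by (simp add: node_weight_nonneg)
    have "(\<Sum>j<n. g j) \<le> (\<Sum>j<n. C * ?c (k j + 2) (k (Suc j) + 2))"
      by (intro sum_mono g le) auto
    also have "\<dots> = C * (\<Sum>j<n. ?c (k j + 2) (k (Suc j) + 2))"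
      by (simp add: sum_distrib_left)
    also have "(\<Sum>j<n. ?c (k j + 2) (k (Suc j) + 2)) \<le> ?c (k 0 + 2) (k n + 2)"
      unfolding control_def
      by (rule dyadic_sum_partition[of _ n "\<lambda>j. k j + 2", OF nn]) (use le in auto)
    also have "?c (k 0 + 2) (k n + 2) \<le> ?c 2 (k n + 2)"
      unfolding control_def using nn by (intro dyadic_sum_mono) auto
    finally have "ennreal (\<Sum>j<n. g j) \<le> ennreal (C * ?c 2 (k n + 2))"
      using \<open>0 \<le> C\<close> by (simp add: mult_left_mono ennreal_leI)
    also have "\<dots> = ennreal C * ennreal (?c 2 (k n + 2))"
      using \<open>0 \<le> C\<close> by (simp add: ennreal_mult')
    also have "\<dots> \<le> ennreal C * T"
      unfolding T_def by (intro mult_left_mono SUP_upper) auto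
    finally show ?thesis .
  qed
  have "p_variation 2 (increments \<gamma>) \<le> ennreal_powr (ennreal 3 * T) (1 / 2)"
  proof (rule p_variation_le)
    fix n and k :: "nat \<Rightarrow> nat" assume k: "strict_mono_on {..n} k"
    show "ennreal (\<Sum>j<n. norm (increments \<gamma> (k j) (k (Suc j))) powr 2) \<le> ennreal 3 * T"
      using path_control(1)[OF N, of _ _ \<gamma>]
      by (intro part[OF k]) (auto simp: increments_def norm_minus_commute)
  qed simp
  then have "(p_variation 2 (increments \<gamma>))\<^sup>2 \<le> (ennreal_powr (ennreal 3 * T) (1 / 2))\<^sup>2"
    by (intro power_mono) auto
  also have "\<dots> = ennreal 3 * T" by (rule ennreal_powr_half_power2)
  finally have 1: "(p_variation 2 (increments \<gamma>))\<^sup>2 \<le> ennreal 3 * T" .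
  have "p_variation 1 (area \<iota> \<gamma>) \<le> ennreal_powr (ennreal 2 * T) (1 / 1)"
  proof (rule p_variation_le)
    fix n and k :: "nat \<Rightarrow> nat" assume k: "strict_mono_on {..n} k"
    show "ennreal (\<Sum>j<n. norm (area \<iota> \<gamma> (k j) (k (Suc j))) powr 1) \<le> ennreal 2 * T"
      using path_control(2)[OF N, of _ _ \<gamma>] by (intro part[OF k]) auto
  qed simp
  then have 2: "p_variation 1 (area \<iota> \<gamma>) \<le> ennreal 2 * T" by (simp add: ennreal_powr_1)
  have "(rough_norm \<gamma> (area \<iota> \<gamma>))\<^sup>2 \<le> ennreal 3 * T + ennreal 2 * T"
    unfolding rough_norm_def ennreal_powr_half_power2 using 1 2 by (rule add_mono)
  also have "\<dots> = 5 * T" by (simp flip: distrib_right)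
  finally show ?thesis .
qed

text \<open>
  A single increment is a partition with one interval. Unbounded increments are therefore enough to
  violate the rough path property.
\<close>
lemma rough_norm_finite_imp_bounded:
  assumes "rough_norm \<gamma> \<alpha> < \<infinity>"
  shows "\<exists>B. \<forall>k1 k2. k1 < k2 \<longrightarrow> norm (\<gamma> k1 - \<gamma> k2) \<le> B"
proof -
  define V where "V = p_variation 2 (increments \<gamma>)"
  have "V\<^sup>2 + p_variation 1 \<alpha> = (rough_norm \<gamma> \<alpha>)\<^sup>2"
    by (simp add: rough_norm_def ennreal_powr_half_power2 V_def)
  also have "\<dots> < \<infinity>" using assms by (simp add: power2_eq_square ennreal_mult_less_top)
  finally have "V < \<infinity>" by (auto simp: power2_eq_square ennreal_mult_less_top less_top[symmetric])
  have "norm (\<gamma> k1 - \<gamma> k2) \<le> enn2real V" if "k1 < k2" for k1 k2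
  proof -
    define k where "k j = (if j = 0 then k1 else k2)" for j :: nat
    let ?S = "\<lambda>N. (SUP (n, k)\<in>{(n :: nat, k :: nat \<Rightarrow> nat). strict_mono_on {..n} k \<and> k n \<le> N}.
        ennreal (\<Sum>j<n. norm (increments \<gamma> (k j) (k (Suc j))) powr 2))"
    have "(1, k) \<in> {(n, k). strict_mono_on {..n} k \<and> k n \<le> k2}"
      using that by (auto simp: k_def strict_mono_on_def)
    from SUP_upper[OF this, of "\<lambda>(n, k). ennreal (\<Sum>j<n. norm (increments \<gamma> (k j) (k (Suc j))) powr 2)"]
    have "ennreal ((norm (\<gamma> k1 - \<gamma> k2))\<^sup>2) \<le> ?S k2"
      by (simp add: k_def increments_def)
    then have "ennreal_powr (ennreal ((norm (\<gamma> k1 - \<gamma> k2))\<^sup>2)) (1 / 2) \<le> ennreal_powr (?S k2) (1 / 2)"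
      by (rule ennreal_powr_mono) simp
    also have "\<dots> \<le> V"
      unfolding V_def p_variation_def using that by (intro SUP_upper) auto
    finally have "ennreal (norm (\<gamma> k1 - \<gamma> k2)) \<le> V"
      by (simp add: ennreal_powr_def powr_half_sqrt)
    then show ?thesis using \<open>V < \<infinity>\<close>
      by (metis enn2real_ennreal enn2real_mono infinity_ennreal_def norm_ge_zero)
  qed
  then show ?thesis by blast
qed

section \<open>The expectation of the control\<close>

text \<open>
  The integrand is expanded into inner products, because sums of measurable maps into a non-separable
  space may fail to be measurable.
\<close>
lemma has_bochner_integral_norm_sum_power2:
  assumes "orthonormal_system M u" "finite F"
  shows "has_bochner_integral M (\<lambda>\<omega>. (norm (\<Sum>n\<in>F. c n *\<^sub>R u n \<omega>))\<^sup>2) (\<Sum>n\<in>F. (c n)\<^sup>2)"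
proof -
  have "has_bochner_integral M (\<lambda>\<omega>. \<Sum>n\<in>F. \<Sum>m\<in>F. c n * c m * (u n \<omega> \<bullet> u m \<omega>))
      (\<Sum>n\<in>F. \<Sum>m\<in>F. c n * c m * (if m = n then 1 else 0))"
    using assms(1) unfolding orthonormal_system_def
    by (intro has_bochner_integral_sum has_bochner_integral_mult_right) auto
  moreover have "(\<Sum>n\<in>F. \<Sum>m\<in>F. c n * c m * (u n \<omega> \<bullet> u m \<omega>)) = (norm (\<Sum>n\<in>F. c n *\<^sub>R u n \<omega>))\<^sup>2" for \<omega>
    by (simp add: power2_norm_eq_inner inner_sum_left inner_sum_right mult_ac inner_commute)
  moreover have "(\<Sum>n\<in>F. \<Sum>m\<in>F. c n * c m * (if m = n then 1 else 0)) = (\<Sum>n\<in>F. (c n)\<^sup>2)"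
    using assms(2) by (simp add: if_distrib sum.delta power2_eq_square cong: if_cong)
  ultimately show ?thesis by simp
qed

lemma path_increment_partial_sum:
  assumes "2 \<le> a" "a \<le> b"
  shows "path_increment (partial_sum_process c u \<omega>) a b = norm (\<Sum>j=a-1..<b-1. c j *\<^sub>R u j \<omega>)"
proof -
  have "(\<Sum>k\<le>b-2. c k *\<^sub>R u k \<omega>) - (\<Sum>k\<le>a-2. c k *\<^sub>R u k \<omega>) = (\<Sum>j\<in>{..b-2}-{..a-2}. c j *\<^sub>R u j \<omega>)"
    using assms by (intro sum_diff[symmetric]) auto
  also have "{..b-2}-{..a-2} = {a-1..<b-1}" using assms by auto
  finally show ?thesis by (simp add: path_increment_def partial_sum_process_def)
qed

text \<open>
  For \<open>2\<^sup>i \<le> x < 2\<^sup>i\<^sup>+\<^sup>1\<close> there is one node of each level \<open>l \<le> i\<close> around \<open>x\<close>. The nodes with \<open>l < i\<close> have weight at most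
  \<open>1 + log x\<close>, and the node with \<open>l = i\<close> is the block, of weight \<open>(i + 1)\<^sup>2\<close>.
\<close>
lemma node_weight_sum_le:
  assumes "2 \<le> x"
  shows "(\<Sum>(l, m)\<in>{(l, m)\<in>dyadics 2 n. m * 2 ^ l \<le> x \<and> x < (m + 1) * 2 ^ l}. node_weight l m)
    \<le> 6 * (log 2 (real x))\<^sup>2"
proof -
  define i L where "i = floor_log x" and "L = log 2 (real x)"
  have i: "2 ^ i \<le> x" "x < 2 ^ Suc i"
    using floor_log_exp2_le[of x] floor_log_exp2_gt[of x] assms by (auto simp: i_def)
  have "real (2 ^ i) \<le> real x" using i(1) by (rule of_nat_mono)
  then have "log 2 (2 ^ i) \<le> L"
    unfolding L_def using assms by (subst log_le_cancel_iff) auto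
  then have iL: "real i \<le> L" by simp
  have L: "1 \<le> L" unfolding L_def using assms by (simp add: le_log_iff)
  have sub: "{(l, m)\<in>dyadics 2 n. m * 2 ^ l \<le> x \<and> x < (m + 1) * 2 ^ l} \<subseteq> (\<lambda>l. (l, x div 2 ^ l)) ` {..i}"
  proof (clarsimp simp: dyadics_def)
    fix l m :: nat
    assume lm: "2 \<le> m * 2 ^ l" "m * 2 ^ l \<le> x" "x < 2 ^ l + m * 2 ^ l"
    have "x div 2 ^ l = m"
      using lm by (intro div_nat_eqI) (auto simp: algebra_simps)
    moreover have "m \<noteq> 0" using lm(1) by (cases m) auto
    then have "2 ^ l \<le> m * 2 ^ l" by simp
    then have "(2::nat) ^ l < 2 ^ Suc i" using lm(2) i(2) by linarith
    then have "l < Suc i" by (simp only: power_strict_increasing_iff[of "2::nat"] one_less_numeral_iff semiring_norm)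
    ultimately show "(l, m) \<in> (\<lambda>l. (l, x div 2 ^ l)) ` {..i}" by auto
  qed
  have "(\<Sum>(l, m)\<in>{(l, m)\<in>dyadics 2 n. m * 2 ^ l \<le> x \<and> x < (m + 1) * 2 ^ l}. node_weight l m)
      \<le> (\<Sum>(l, m)\<in>(\<lambda>l. (l, x div 2 ^ l)) ` {..i}. node_weight l m)"
    by (intro sum_mono2 sub) (auto simp: node_weight_nonneg)
  also have "\<dots> = (\<Sum>l\<le>i. node_weight l (x div 2 ^ l))"
    by (subst sum.reindex) (auto simp: inj_on_def)
  also have "\<dots> = (\<Sum>l<i. node_weight l (x div 2 ^ l)) + node_weight i (x div 2 ^ i)"
    by (simp flip: lessThan_Suc_atMost)
  also have "(\<Sum>l<i. node_weight l (x div 2 ^ l)) \<le> (\<Sum>l<i. 1 + L)"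
  proof (intro sum_mono)
    fix l assume "l \<in> {..<i}"
    then have "(2::nat) * 2 ^ l \<le> 2 ^ i"
      by (metis Suc_leI lessThan_iff numeral_One one_le_numeral power_Suc power_increasing)
    then have "2 * 2 ^ l \<le> x" using i(1) by linarith
    then have "2 \<le> x div 2 ^ l" by (simp add: less_eq_div_iff_mult_less_eq)
    moreover have "x div 2 ^ l * 2 ^ l \<le> x" by simp
    then have "real (x div 2 ^ l * 2 ^ l) \<le> real x" by (rule of_nat_mono)
    then have "log 2 (real (x div 2 ^ l * 2 ^ l)) \<le> L"
      unfolding L_def using calculation assms by (subst log_le_cancel_iff) auto
    ultimately show "node_weight l (x div 2 ^ l) \<le> 1 + L"
      using L by (simp add: node_weight_def)
  qed
  also have "(\<Sum>l<i. 1 + L) = real i * (1 + L)" by simp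
  also have "\<dots> \<le> L * (1 + L)" using iL L by (intro mult_right_mono) auto
  also have "node_weight i (x div 2 ^ i) = (real i + 1)\<^sup>2"
  proof -
    have "x div 2 ^ i = 1" using i by (intro div_nat_eqI) auto
    then show ?thesis by (simp add: node_weight_def)
  qed
  also have "\<dots> \<le> (L + 1)\<^sup>2" using iL by (intro power_mono) auto
  also have "L * (1 + L) + (L + 1)\<^sup>2 = 2 * L\<^sup>2 + 3 * L + 1" by (simp add: power2_eq_square algebra_simps)
  also have "\<dots> \<le> 6 * L\<^sup>2"
    using L mult_mono[OF L L] mult_left_mono[OF L, of L] unfolding power2_eq_square by linarith
  finally show ?thesis by (simp add: L_def)
qed

lemma has_bochner_integral_control:
  assumes "orthonormal_system M u"
  shows "has_bochner_integral M (\<lambda>\<omega>. control (path_increment (partial_sum_process c u \<omega>)) 2 n)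
    (\<Sum>(l, m)\<in>dyadics 2 n. node_weight l m * (\<Sum>j=m*2^l-1..<(m+1)*2^l-1. (c j)\<^sup>2))"
proof -
  have "has_bochner_integral M
      (\<lambda>\<omega>. \<Sum>D\<in>dyadics 2 n. node_weight (fst D) (snd D) *
        (norm (\<Sum>j=snd D*2^fst D-1..<(snd D+1)*2^fst D-1. c j *\<^sub>R u j \<omega>))\<^sup>2)
      (\<Sum>D\<in>dyadics 2 n. node_weight (fst D) (snd D) *
        (\<Sum>j=snd D*2^fst D-1..<(snd D+1)*2^fst D-1. (c j)\<^sup>2))"
    by (intro has_bochner_integral_sum has_bochner_integral_mult_right
        has_bochner_integral_norm_sum_power2[OF assms]) auto
  moreover have "control (path_increment (partial_sum_process c u \<omega>)) 2 n
    = (\<Sum>D\<in>dyadics 2 n. node_weight (fst D) (snd D) *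
        (norm (\<Sum>j=snd D*2^fst D-1..<(snd D+1)*2^fst D-1. c j *\<^sub>R u j \<omega>))\<^sup>2)" for \<omega>
    unfolding control_def dyadic_sum_def
    by (intro sum.cong refl) (auto simp: dyadics_def path_increment_partial_sum split: prod.splits)
  ultimately show ?thesis by (simp add: case_prod_beta)
qed

lemma expected_control_le:
  assumes "summable (\<lambda>n. (log 2 (real n + 1))\<^sup>2 * \<bar>c n\<bar>\<^sup>2)"
  shows "(\<Sum>(l, m)\<in>dyadics 2 n. node_weight l m * (\<Sum>j=m*2^l-1..<(m+1)*2^l-1. (c j)\<^sup>2))
    \<le> 6 * suminf (\<lambda>n. (log 2 (real n + 1))\<^sup>2 * \<bar>c n\<bar>\<^sup>2)"
proof -
  \<comment> \<open>The coefficient with index \<open>j\<close> belongs to the point \<open>j + 1\<close> of the dyadic tree.\<close>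
  let ?R = "\<lambda>D j. snd D * 2 ^ fst D \<le> Suc j \<and> Suc j < (snd D + 1) * 2 ^ fst D"
  have iv: "{m*2^l-1..<(m+1)*2^l-1} = {j\<in>{1..<n}. ?R (l, m) j}" if "(l, m) \<in> dyadics 2 n" for l m
    using that by (auto simp: dyadics_def)
  have "(\<Sum>(l, m)\<in>dyadics 2 n. node_weight l m * (\<Sum>j=m*2^l-1..<(m+1)*2^l-1. (c j)\<^sup>2))
      = (\<Sum>D\<in>dyadics 2 n. \<Sum>j\<in>{j\<in>{1..<n}. ?R D j}. node_weight (fst D) (snd D) * (c j)\<^sup>2)"
  proof (intro sum.cong refl)
    fix D assume D: "D \<in> dyadics 2 n"
    obtain l m where "D = (l, m)" by (cases D)
    with iv[of l m] D show "(case D of (l, m) \<Rightarrow> node_weight l m * (\<Sum>j=m*2^l-1..<(m+1)*2^l-1. (c j)\<^sup>2))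
        = (\<Sum>j\<in>{j\<in>{1..<n}. ?R D j}. node_weight (fst D) (snd D) * (c j)\<^sup>2)"
      by (simp only: sum_distrib_left fst_conv snd_conv prod.case)
  qed
  also have "\<dots> = (\<Sum>j=1..<n. \<Sum>D\<in>{D\<in>dyadics 2 n. ?R D j}. node_weight (fst D) (snd D) * (c j)\<^sup>2)"
    by (intro sum.swap_restrict finite_dyadics) auto
  also have "\<dots> \<le> (\<Sum>j=1..<n. 6 * ((log 2 (real j + 1))\<^sup>2 * \<bar>c j\<bar>\<^sup>2))"
  proof (intro sum_mono)
    fix j assume j: "j \<in> {1..<n}"
    have "(\<Sum>D\<in>{D\<in>dyadics 2 n. ?R D j}. node_weight (fst D) (snd D)) \<le> 6 * (log 2 (real (Suc j)))\<^sup>2"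
    proof -
      have "{D\<in>dyadics 2 n. ?R D j}
          = {(l, m)\<in>dyadics 2 n. m * 2 ^ l \<le> Suc j \<and> Suc j < (m + 1) * 2 ^ l}"
        by auto
      then show ?thesis using node_weight_sum_le[of "Suc j" n] j by (simp add: case_prod_beta)
    qed
    then have "(\<Sum>D\<in>{D\<in>dyadics 2 n. ?R D j}. node_weight (fst D) (snd D)) * (c j)\<^sup>2
        \<le> 6 * (log 2 (real (Suc j)))\<^sup>2 * (c j)\<^sup>2"
      by (intro mult_right_mono) auto
    then show "(\<Sum>D\<in>{D\<in>dyadics 2 n. ?R D j}. node_weight (fst D) (snd D) * (c j)\<^sup>2)
        \<le> 6 * ((log 2 (real j + 1))\<^sup>2 * \<bar>c j\<bar>\<^sup>2)"
      by (simp add: sum_distrib_right add.commute mult.assoc)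
  qed
  also have "\<dots> = 6 * (\<Sum>j=1..<n. (log 2 (real j + 1))\<^sup>2 * \<bar>c j\<bar>\<^sup>2)"
    by (simp add: sum_distrib_left)
  also have "\<dots> \<le> 6 * suminf (\<lambda>n. (log 2 (real n + 1))\<^sup>2 * \<bar>c n\<bar>\<^sup>2)"
    by (intro mult_left_mono sum_le_suminf[OF assms]) auto
  finally show ?thesis .
qed

lemma control_mono_right: "n \<le> n' \<Longrightarrow> control s a n \<le> control s a n'"
  unfolding control_def by (intro dyadic_sum_mono) (auto simp: node_weight_nonneg)

text \<open>
  The supremum of the controls is measurable, unlike, possibly, the rough norm itself; its integral is
  obtained by monotone convergence.
\<close>
lemma nn_integral_rough_norm_le:
  fixes u :: "nat \<Rightarrow> 'a \<Rightarrow> 'v::{real_inner, banach}" and \<iota> :: "'v tensor_square \<Rightarrow> 'e::banach"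
  assumes N: "tensor_norm N" "tensor_completion N \<iota>"
    and u: "orthonormal_system M u"
    and c: "summable (\<lambda>n. (log 2 (real n + 1))\<^sup>2 * \<bar>c n\<bar>\<^sup>2)"
  defines "X \<equiv> partial_sum_process c u"
  shows "geometric_rough_process \<iota> M X"
    and "(\<integral>\<^sup>+ \<omega>. (rough_norm (X \<omega>) (area \<iota> (X \<omega>)))\<^sup>2 \<partial>M)
      \<le> ennreal (30 * suminf (\<lambda>n. (log 2 (real n + 1))\<^sup>2 * \<bar>c n\<bar>\<^sup>2))"
proof -
  define W where "W = suminf (\<lambda>n. (log 2 (real n + 1))\<^sup>2 * \<bar>c n\<bar>\<^sup>2)"
  define f where "f n \<omega> = ennreal (control (path_increment (X \<omega>)) 2 n)" for n \<omega>
  note hbi = has_bochner_integral_control[OF u, of c, folded X_def]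
  have meas: "f n \<in> borel_measurable M" for n
    unfolding f_def using hbi[of n]
    by (intro measurable_compose[OF _ measurable_ennreal])
       (auto simp: has_bochner_integral_iff)
  have mono: "incseq f"
    by (auto simp: incseq_def le_fun_def f_def intro!: ennreal_leI control_mono_right)
  have "integral\<^sup>N M (f n) \<le> ennreal (6 * W)" for n
  proof -
    have "integral\<^sup>N M (f n) = ennreal (\<Sum>(l, m)\<in>dyadics 2 n.
        node_weight l m * (\<Sum>j=m*2^l-1..<(m+1)*2^l-1. (c j)\<^sup>2))"
      unfolding f_def using hbi[of n]
      by (subst nn_integral_eq_integral) (auto simp: has_bochner_integral_iff control_nonneg)
    also have "\<dots> \<le> ennreal (6 * W)"
      unfolding W_def by (intro ennreal_leI expected_control_le c)
    finally show ?thesis .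
  qed
  then have T: "(\<integral>\<^sup>+ \<omega>. (SUP n. f n \<omega>) \<partial>M) \<le> ennreal (6 * W)"
    using nn_integral_monotone_convergence_SUP[OF mono meas] by (simp add: SUP_le_iff)
  have bound: "(rough_norm (X \<omega>) (area \<iota> (X \<omega>)))\<^sup>2 \<le> 5 * (SUP n. f n \<omega>)" for \<omega>
    unfolding f_def by (rule rough_norm_power2_le[OF N])
  have "AE \<omega> in M. (SUP n. f n \<omega>) \<noteq> \<infinity>"
    using T meas by (intro nn_integral_PInf_AE) (auto simp: top_unique)
  then show "geometric_rough_process \<iota> M X"
    unfolding geometric_rough_process_def geometric_rough_path_def
  proof eventually_elim
    case (elim \<omega>)
    then have "5 * (SUP n. f n \<omega>) < \<infinity>"
      by (simp only: ennreal_mult_less_top infinity_ennreal_def less_top) simp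
    with bound[of \<omega>] have "(rough_norm (X \<omega>) (area \<iota> (X \<omega>)))\<^sup>2 < \<infinity>" by (rule le_less_trans)
    then show ?case by (cases "rough_norm (X \<omega>) (area \<iota> (X \<omega>)) = \<infinity>") (auto simp: less_top[symmetric])
  qed
  have "(\<integral>\<^sup>+ \<omega>. (rough_norm (X \<omega>) (area \<iota> (X \<omega>)))\<^sup>2 \<partial>M) \<le> (\<integral>\<^sup>+ \<omega>. 5 * (SUP n. f n \<omega>) \<partial>M)"
    by (intro nn_integral_mono bound)
  also have "\<dots> = 5 * (\<integral>\<^sup>+ \<omega>. (SUP n. f n \<omega>) \<partial>M)"
    using meas by (intro nn_integral_cmult) auto
  also have "\<dots> \<le> 5 * ennreal (6 * W)" by (intro mult_left_mono T) auto
  also have "\<dots> = ennreal (30 * W)"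
    by (simp add: ennreal_mult'[symmetric] flip: ennreal_numeral)
  finally show "(\<integral>\<^sup>+ \<omega>. (rough_norm (X \<omega>) (area \<iota> (X \<omega>)))\<^sup>2 \<partial>M)
      \<le> ennreal (30 * suminf (\<lambda>n. (log 2 (real n + 1))\<^sup>2 * \<bar>c n\<bar>\<^sup>2))"
    by (simp add: W_def)
qed

section \<open>A Hilbert matrix on the integers\<close>

lemma UNIV_int: "(UNIV :: int set) = range int \<union> range (\<lambda>n. - 1 - int n)"
proof -
  have "x \<in> range int \<union> range (\<lambda>n. - 1 - int n)" for x
  proof (cases "0 \<le> x")
    case True
    then show ?thesis by (auto intro: range_eqI[of _ _ "nat x"])
  next
    case False
    then show ?thesis by (auto intro: range_eqI[of _ _ "nat (- 1 - x)"])
  qed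
  then show ?thesis by auto
qed

lemma integrable_count_space_int:
  fixes f :: "int \<Rightarrow> real"
  assumes "summable (\<lambda>n. norm (f (int n)))" "summable (\<lambda>n. norm (f (- 1 - int n)))"
  shows "integrable (count_space UNIV) f"
proof -
  have "Infinite_Set_Sum.abs_summable_on f (range int)"
    "Infinite_Set_Sum.abs_summable_on f (range (\<lambda>n. - 1 - int n))"
    using assms by (auto intro!: abs_summable_on_reindex simp: abs_summable_on_nat_iff')
  then have "Infinite_Set_Sum.abs_summable_on f UNIV" unfolding UNIV_int by (rule abs_summable_on_union)
  then show ?thesis by (simp add: abs_summable_on_def)
qed

lemma integral_count_space_int:
  fixes f :: "int \<Rightarrow> real"
  assumes "integrable (count_space UNIV) f"
    and "(\<lambda>n. f (int n)) sums a" "(\<lambda>n. f (- 1 - int n)) sums b"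
  shows "(\<integral>i. f i \<partial>count_space UNIV) = a + b"
proof -
  have f: "Infinite_Set_Sum.abs_summable_on f A" for A
    using assms(1) by (auto simp: abs_summable_on_def intro: abs_summable_on_subset[unfolded abs_summable_on_def])
  have inj: "inj int" "inj (\<lambda>n. - 1 - int n)" by (auto simp: inj_def)
  have "(\<integral>i. f i \<partial>count_space UNIV) = infsetsum f (range int \<union> range (\<lambda>n. - 1 - int n))"
    unfolding UNIV_int[symmetric] by (simp add: infsetsum_def)
  also have "\<dots> = infsetsum f (range int) + infsetsum f (range (\<lambda>n. - 1 - int n))"
    by (intro infsetsum_Un_disjoint f) auto
  also have "infsetsum f (range int) = a"
    using f[of "range int"] assms(2) inj
    by (simp add: infsetsum_reindex infsetsum_nat' sums_iff flip: abs_summable_on_reindex_iff)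
  also have "infsetsum f (range (\<lambda>n. - 1 - int n)) = b"
    using f[of "range (\<lambda>n. - 1 - int n)"] assms(3) inj
    by (simp add: infsetsum_reindex infsetsum_nat' sums_iff flip: abs_summable_on_reindex_iff)
  finally show ?thesis .
qed

lemma integral_count_space_telescope:
  fixes T :: "int \<Rightarrow> real"
  assumes "integrable (count_space UNIV) (\<lambda>i. T i - T (i - 1))"
    and "(\<lambda>n. T (int n)) \<longlonglongrightarrow> 0" "(\<lambda>n. T (- 1 - int n)) \<longlonglongrightarrow> 0"
  shows "(\<integral>i. T i - T (i - 1) \<partial>count_space UNIV) = 0"
proof -
  have "(\<lambda>n. T (int n - 1)) \<longlonglongrightarrow> 0"
    by (rule LIMSEQ_imp_Suc) (use assms(2) in simp)
  from telescope_sums[OF this] have 1: "(\<lambda>n. T (int n) - T (int n - 1)) sums (0 - T (- 1))" by simp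
  from telescope_sums'[OF assms(3)]
  have 2: "(\<lambda>n. T (- 1 - int n) - T (- 1 - int n - 1)) sums (T (- 1) - 0)" by (simp add: algebra_simps)
  from integral_count_space_int[OF assms(1) 1 2] show ?thesis by simp
qed

text \<open>
  Integrals of functions that are constant on the cells \<open>[i / a, (i + 1) / a)\<close> become sums over the integers.
\<close>
lemma distr_floor:
  assumes "0 < a"
  shows "distr lborel (count_space UNIV) (\<lambda>x. \<lfloor>a * x\<rfloor>) = density (count_space (UNIV :: int set)) (\<lambda>_. ennreal (1 / a))"
proof (rule measure_eqI_countable)
  fix i :: int
  have m: "(\<lambda>x. \<lfloor>a * x\<rfloor>) \<in> borel \<rightarrow>\<^sub>M count_space UNIV" by measurable
  have "(\<lambda>x. \<lfloor>a * x\<rfloor>) -` {i} = {real_of_int i / a ..< (real_of_int i + 1) / a}"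
    using assms by (intro set_eqI) (simp add: floor_eq_iff pos_divide_le_eq pos_less_divide_eq mult.commute)
  then have "emeasure (distr lborel (count_space UNIV) (\<lambda>x. \<lfloor>a * x\<rfloor>)) {i}
      = ennreal ((real_of_int i + 1) / a - real_of_int i / a)"
    using assms m by (subst emeasure_distr) (auto simp: divide_right_mono)
  also have "(real_of_int i + 1) / a - real_of_int i / a = 1 / a" by (simp add: add_divide_distrib)
  finally show "emeasure (distr lborel (count_space UNIV) (\<lambda>x. \<lfloor>a * x\<rfloor>)) {i}
      = emeasure (density (count_space UNIV) (\<lambda>_. ennreal (1 / a))) {i}"
    by (simp add: emeasure_density nn_integral_cmult_indicator)
qed (auto simp: sets_eq_iff_bounded)

lemma
  fixes \<Phi> :: "int \<Rightarrow> real"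
  assumes "0 < a"
  shows integrable_floor:
      "integrable lborel (\<lambda>x. \<Phi> \<lfloor>a * x\<rfloor>) \<longleftrightarrow> integrable (count_space UNIV) \<Phi>" (is ?I)
    and integral_floor:
      "(\<integral>x. \<Phi> \<lfloor>a * x\<rfloor> \<partial>lborel) = (\<integral>i. \<Phi> i \<partial>count_space UNIV) / a" (is ?J)
    and borel_measurable_floor_comp: "(\<lambda>x. \<Phi> \<lfloor>a * x\<rfloor>) \<in> borel_measurable borel" (is ?K)
proof -
  have m: "(\<lambda>x. \<lfloor>a * x\<rfloor>) \<in> borel \<rightarrow>\<^sub>M count_space UNIV" by measurable
  then have m': "(\<lambda>x. \<lfloor>a * x\<rfloor>) \<in> lborel \<rightarrow>\<^sub>M count_space UNIV" by simp
  show ?K by (rule measurable_compose[OF m]) simp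
  have "integrable lborel (\<lambda>x. \<Phi> \<lfloor>a * x\<rfloor>)
      \<longleftrightarrow> integrable (density (count_space UNIV) (\<lambda>_. ennreal (1 / a))) \<Phi>"
    by (subst integrable_distr_eq[OF m', symmetric]) (auto simp: distr_floor[OF assms])
  also have "\<dots> \<longleftrightarrow> integrable (count_space UNIV) \<Phi>"
    using assms by (subst integrable_density) (auto simp only: real_scaleR_def integrable_mult_left_iff, auto)
  finally show ?I .
  have "(\<integral>x. \<Phi> \<lfloor>a * x\<rfloor> \<partial>lborel) = (\<integral>i. \<Phi> i \<partial>density (count_space UNIV) (\<lambda>_. ennreal (1 / a)))"
    by (subst integral_distr[OF m', symmetric]) (auto simp: distr_floor[OF assms])
  also have "\<dots> = (\<integral>i. \<Phi> i \<partial>count_space UNIV) / a"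
    using assms by (subst integral_density) auto
  finally show ?J .
qed

text \<open>
  The matrix \<open>h(i - j)\<close> is a multiple of an orthogonal matrix on \<open>\<ell>\<^sup>2(\<int>)\<close>, a variant of the Hilbert matrix. The
  shift by \<open>1/2\<close> avoids a pole.
\<close>
definition hilbert_kernel :: "int \<Rightarrow> real" where
  "hilbert_kernel i = 1 / (of_int i + 1 / 2)"

lemma half_int_nonzero: "of_int i + 1 / 2 \<noteq> (0::real)"
proof
  assume "of_int i + 1 / 2 = (0::real)"
  then have "of_int (2 * i + 1) = (of_int 0 :: real)" by simp
  then have "2 * i + 1 = 0" by (simp only: of_int_eq_iff)
  then show False by presburger
qed

lemma integrable_shift_iff:
  fixes f :: "int \<Rightarrow> real"
  shows "integrable (count_space UNIV) (\<lambda>i. f (i - j)) \<longleftrightarrow> integrable (count_space UNIV) f"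
    and "(\<integral>i. f (i - j) \<partial>count_space UNIV) = (\<integral>i. f i \<partial>count_space UNIV)"
proof -
  have bij: "bij (\<lambda>i::int. i - j)" by (rule bij_betw_byWitness[of _ "\<lambda>i. i + j"]) auto
  show "integrable (count_space UNIV) (\<lambda>i. f (i - j)) \<longleftrightarrow> integrable (count_space UNIV) f"
    using abs_summable_on_reindex_bij_betw[OF bij, of f] by (simp add: abs_summable_on_def)
  show "(\<integral>i. f (i - j) \<partial>count_space UNIV) = (\<integral>i. f i \<partial>count_space UNIV)"
    using infsetsum_reindex_bij_betw[OF bij, of f] by (simp add: infsetsum_def)
qed

lemma integrable_mult_of_squares:
  fixes f g :: "'a \<Rightarrow> real"
  assumes "integrable M (\<lambda>x. f x * f x)" "integrable M (\<lambda>x. g x * g x)"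
    and [measurable]: "f \<in> borel_measurable M" "g \<in> borel_measurable M"
  shows "integrable M (\<lambda>x. f x * g x)"
proof (rule Bochner_Integration.integrable_bound)
  show "integrable M (\<lambda>x. f x * f x + g x * g x)" using assms by simp
  have "\<bar>a * b\<bar> \<le> a * a + b * b" for a b :: real
  proof -
    have "2 * \<bar>a * b\<bar> \<le> a * a + b * b"
      using sum_squares_bound[of "\<bar>a\<bar>" "\<bar>b\<bar>"] by (simp add: power2_eq_square abs_mult)
    then show ?thesis by linarith
  qed
  then show "AE x in M. norm (f x * g x) \<le> norm (f x * f x + g x * g x)"
    by (intro AE_I2) (simp add: abs_le_iff)
qed measurable

lemma integrable_hilbert_kernel_mult:
  "integrable (count_space UNIV) (\<lambda>i. hilbert_kernel (i - j) * hilbert_kernel (i - k))"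
proof -
  have neg: "hilbert_kernel (- 1 - int n) = - hilbert_kernel (int n)" for n
    using half_int_nonzero[of "int n"] by (simp add: hilbert_kernel_def divide_simps)
  have "summable (\<lambda>n. 4 * inverse ((real (Suc n))\<^sup>2))"
    by (intro summable_mult) (subst summable_Suc_iff, rule inverse_power_summable, simp)
  then have s: "summable (\<lambda>n. norm ((hilbert_kernel (int n))\<^sup>2))"
  proof (rule summable_comparison_test')
    fix n :: nat
    have "1 / (real n + 1 / 2) \<le> 2 / real (Suc n)" by (simp add: field_simps)
    then have "(1 / (real n + 1 / 2))\<^sup>2 \<le> (2 / real (Suc n))\<^sup>2" by (intro power_mono) auto
    also have "(2 / real (Suc n))\<^sup>2 = 4 * inverse ((real (Suc n))\<^sup>2)"
      by (simp add: power_divide inverse_eq_divide)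
    finally show "norm (norm ((hilbert_kernel (int n))\<^sup>2)) \<le> 4 * inverse ((real (Suc n))\<^sup>2)"
      by (simp add: hilbert_kernel_def)
  qed
  have sq: "integrable (count_space UNIV) (\<lambda>i. hilbert_kernel i * hilbert_kernel i)"
    using s by (intro integrable_count_space_int) (auto simp: neg power2_eq_square)
  show ?thesis
    by (rule integrable_mult_of_squares)
      (auto simp: integrable_shift_iff(1)[of "\<lambda>i. hilbert_kernel i * hilbert_kernel i"] sq)
qed

definition hilbert_norm :: real where
  "hilbert_norm = (\<integral>i. hilbert_kernel i * hilbert_kernel i \<partial>count_space UNIV)"

lemma hilbert_norm_pos: "0 < hilbert_norm"
proof -
  have "hilbert_norm \<noteq> 0"
  proof
    assume "hilbert_norm = 0"
    then have "AE i in count_space UNIV. hilbert_kernel i * hilbert_kernel i = 0"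
      unfolding hilbert_norm_def
      using integrable_hilbert_kernel_mult[of 0 0] by (subst (asm) integral_nonneg_eq_0_iff_AE) auto
    then have "hilbert_kernel 0 = 0" by (simp add: AE_count_space)
    then show False by (simp add: hilbert_kernel_def)
  qed
  moreover have "0 \<le> hilbert_norm" unfolding hilbert_norm_def by (intro integral_nonneg_AE) auto
  ultimately show ?thesis by simp
qed

text \<open>
  By partial fractions the product is a multiple of \<open>h(i - j) - h(i - k)\<close>. For \<open>k = j + d\<close> this is \<open>T(i) - T(i - 1)\<close>,
  where \<open>T\<close> is the sum of \<open>d\<close> successive translates of \<open>h\<close> and vanishes at infinity.
\<close>
lemma hilbert_kernel_orthogonal:
  assumes "j < k"
  shows "(\<integral>i. hilbert_kernel (i - j) * hilbert_kernel (i - k) \<partial>count_space UNIV) = 0"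
proof -
  define d where "d = nat (k - j)"
  have k: "k = j + int d" using assms by (simp add: d_def)
  define T where "T i = (\<Sum>t<d. hilbert_kernel (i - j - int t))" for i
  have T: "T i - T (i - 1) = (of_int j - of_int k) * (hilbert_kernel (i - j) * hilbert_kernel (i - k))" for i
  proof -
    have "T i - T (i - 1) = (\<Sum>t<d. hilbert_kernel (i - j - int t) - hilbert_kernel (i - j - int (Suc t)))"
      by (simp add: T_def sum_subtractf algebra_simps)
    also have "\<dots> = hilbert_kernel (i - j) - hilbert_kernel (i - k)"
      by (subst sum_lessThan_telescope') (simp add: k algebra_simps)
    also have "\<dots> = (of_int j - of_int k) * (hilbert_kernel (i - j) * hilbert_kernel (i - k))"
      using half_int_nonzero[of "i - j"] half_int_nonzero[of "i - k"]
      unfolding hilbert_kernel_def by (simp add: divide_simps) (simp add: algebra_simps)?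
    finally show ?thesis .
  qed
  have "(\<integral>i. T i - T (i - 1) \<partial>count_space UNIV) = 0"
  proof (rule integral_count_space_telescope)
    show "integrable (count_space UNIV) (\<lambda>i. T i - T (i - 1))"
      unfolding T by (intro integrable_mult_right integrable_hilbert_kernel_mult)
    have lim: "(\<lambda>n. inverse (y + real n)) \<longlonglongrightarrow> 0" for y :: real
      by (intro tendsto_inverse_0_at_top filterlim_tendsto_add_at_top[OF tendsto_const]
          filterlim_real_sequentially)
    have "(\<lambda>n. hilbert_kernel (int n - j - int t)) \<longlonglongrightarrow> 0"
      "(\<lambda>n. hilbert_kernel (- 1 - int n - j - int t)) \<longlonglongrightarrow> 0" for t
    proof -
      have 1: "hilbert_kernel (int n - j - int t) = inverse ((1 / 2 - of_int j - real t) + real n)" for n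
        by (simp add: hilbert_kernel_def inverse_eq_divide algebra_simps)
      have 2: "hilbert_kernel (- 1 - int n - j - int t) = - inverse ((1 / 2 + of_int j + real t) + real n)" for n
      proof -
        have e: "real_of_int (- 1 - int n - j - int t) + 1 / 2
            = - ((1 / 2 + of_int j + real t) + real n)" by simp
        show ?thesis
          by (simp only: hilbert_kernel_def e inverse_eq_divide divide_minus_right)
      qed
      show "(\<lambda>n. hilbert_kernel (int n - j - int t)) \<longlonglongrightarrow> 0"
        unfolding 1 by (rule lim)
      show "(\<lambda>n. hilbert_kernel (- 1 - int n - j - int t)) \<longlonglongrightarrow> 0"
        unfolding 2 using tendsto_minus[OF lim] by simp
    qed
    then show "(\<lambda>n. T (int n)) \<longlonglongrightarrow> 0" "(\<lambda>n. T (- 1 - int n)) \<longlonglongrightarrow> 0"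
      unfolding T_def by (auto intro!: tendsto_null_sum)
  qed
  then have "(of_int j - of_int k) * (\<integral>i. hilbert_kernel (i - j) * hilbert_kernel (i - k) \<partial>count_space UNIV) = 0"
    unfolding T by simp
  then show ?thesis using assms by simp
qed

lemma integral_hilbert_kernel_mult:
  "(\<integral>i. hilbert_kernel (i - j) * hilbert_kernel (i - k) \<partial>count_space UNIV)
    = (if j = k then hilbert_norm else 0)"
proof (cases j k rule: linorder_cases)
  case greater
  then show ?thesis using hilbert_kernel_orthogonal[of k j] by (simp add: mult.commute)
next
  case equal
  then show ?thesis
    using integrable_shift_iff(2)[of "\<lambda>i. hilbert_kernel i * hilbert_kernel i" k]
    by (simp add: hilbert_norm_def)
qed (use hilbert_kernel_orthogonal in auto)

definition alternating :: "int \<Rightarrow> real" where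
  "alternating i = (if even i then 1 else - 1)"

text \<open>
  The index \<open>n\<close> with \<open>2\<^sup>q \<le> n + 1 < 2\<^sup>q\<^sup>+\<^sup>1\<close> belongs to block \<open>q\<close>, where it is the translate by \<open>j = n + 1 - 2\<^sup>q\<close>. The
  factor \<open>sqrt(2\<^sup>q)\<close> compensates the length of the cells. The sign takes both values on equal halves of
  every cell.
\<close>
definition menshov :: "nat \<Rightarrow> real \<Rightarrow> real" where
  "menshov n x = (let q = floor_log (Suc n) in
     alternating \<lfloor>2 ^ Suc q * x\<rfloor> * (sqrt (2 ^ q / hilbert_norm) * hilbert_kernel (\<lfloor>2 ^ q * x\<rfloor> - int (Suc n - 2 ^ q))))"

lemma menshov_measurable: "menshov n \<in> borel_measurable borel"
  unfolding menshov_def[abs_def] Let_def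
  by (intro borel_measurable_times borel_measurable_floor_comp borel_measurable_const
      borel_measurable_floor_comp[of _ "\<lambda>i. hilbert_kernel (i - int (Suc n - 2 ^ floor_log (Suc n)))"]) auto

lemma floor_log_level: "2 ^ floor_log (Suc n) \<le> Suc n" "Suc n < 2 * 2 ^ floor_log (Suc n)"
  using floor_log_exp2_le[of "Suc n"] floor_log_exp2_gt[of "Suc n"] by auto

lemma menshov_same_level:
  assumes "floor_log (Suc n) = floor_log (Suc m)"
  shows "has_bochner_integral lborel (\<lambda>x. menshov n x * menshov m x) (if m = n then 1 else 0)"
proof -
  define q where "q = floor_log (Suc n)"
  define \<Phi> where "\<Phi> i = 2 ^ q / hilbert_norm *
    (hilbert_kernel (i - int (Suc n - 2 ^ q)) * hilbert_kernel (i - int (Suc m - 2 ^ q)))" for i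
  have eq: "menshov n x * menshov m x = \<Phi> \<lfloor>2 ^ q * x\<rfloor>" for x
  proof -
    let ?a = "alternating \<lfloor>2 ^ Suc q * x\<rfloor>" and ?r = "sqrt (2 ^ q / hilbert_norm)"
    let ?h = "\<lambda>n. hilbert_kernel (\<lfloor>2 ^ q * x\<rfloor> - int (Suc n - 2 ^ q))"
    have "menshov n x * menshov m x = (?a * (?r * ?h n)) * (?a * (?r * ?h m))"
      using assms unfolding menshov_def Let_def q_def by simp
    also have "\<dots> = (?a * ?a) * ((?r * ?r) * (?h n * ?h m))" by (simp only: mult_ac)
    also have "?a * ?a = 1" by (simp add: alternating_def)
    also have "?r * ?r = 2 ^ q / hilbert_norm" using hilbert_norm_pos by simp
    finally show ?thesis by (simp add: \<Phi>_def)
  qed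
  have "int (Suc n - 2 ^ q) = int (Suc m - 2 ^ q) \<longleftrightarrow> m = n"
    using floor_log_level[of n] floor_log_level[of m] assms by (auto simp: q_def)
  then have int: "(\<integral>i. \<Phi> i \<partial>count_space UNIV) = (if m = n then 2 ^ q else 0)"
    unfolding \<Phi>_def using hilbert_norm_pos by (simp add: integral_hilbert_kernel_mult)
  have "integrable (count_space UNIV) \<Phi>"
    unfolding \<Phi>_def by (intro integrable_mult_right integrable_hilbert_kernel_mult)
  then show ?thesis
    unfolding has_bochner_integral_iff eq using int
    by (subst integrable_floor, simp, subst integral_floor) auto
qed

lemma floor_power2_div:
  fixes x :: real
  assumes "a \<le> b"
  shows "\<lfloor>2 ^ a * x\<rfloor> = \<lfloor>2 ^ b * x\<rfloor> div 2 ^ (b - a)"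
proof -
  obtain c where c: "b = a + c" using assms by (auto simp: le_iff_add)
  have "2 ^ a * x = 2 ^ b * x / real_of_int (2 ^ c)"
    by (simp add: c power_add)
  also have "\<lfloor>\<dots>\<rfloor> = \<lfloor>2 ^ b * x\<rfloor> div 2 ^ c"
    by (rule floor_divide_real_eq_div) simp
  finally show ?thesis by (simp add: c)
qed

text \<open>
  On each cell of the finer block the function of the coarser block is constant, and the sign of the
  finer block has mean zero. The involution \<open>\<tau>\<close> of the integers exchanges the halves of the cells.
\<close>
lemma menshov_cross_level:
  assumes "floor_log (Suc n) < floor_log (Suc m)"
  shows "(\<integral>x. menshov n x * menshov m x \<partial>lborel) = 0"
proof -
  define p q where "p = floor_log (Suc n)" and "q = floor_log (Suc m)"
  have "p < q" using assms by (simp add: p_def q_def)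
  define G where "G i = alternating (i div 2 ^ (q - Suc p)) *
      (sqrt (2 ^ p / hilbert_norm) * hilbert_kernel (i div 2 ^ (q - p) - int (Suc n - 2 ^ p))) *
      (sqrt (2 ^ q / hilbert_norm) * hilbert_kernel (i - int (Suc m - 2 ^ q)))" for i
  define \<Phi> where "\<Phi> i = alternating i * G (i div 2)" for i
  have eq: "menshov n x * menshov m x = \<Phi> \<lfloor>2 ^ Suc q * x\<rfloor>" for x
  proof -
    have "\<lfloor>2 ^ q * x\<rfloor> = \<lfloor>2 ^ Suc q * x\<rfloor> div 2"
      using floor_power2_div[of q "Suc q" x] by simp
    moreover have "\<lfloor>2 ^ p * x\<rfloor> = \<lfloor>2 ^ q * x\<rfloor> div 2 ^ (q - p)"
      using \<open>p < q\<close> by (intro floor_power2_div) auto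
    moreover have "\<lfloor>2 ^ Suc p * x\<rfloor> = \<lfloor>2 ^ q * x\<rfloor> div 2 ^ (q - Suc p)"
      using \<open>p < q\<close> by (intro floor_power2_div) auto
    ultimately show ?thesis
      unfolding \<Phi>_def G_def menshov_def p_def[symmetric] q_def[symmetric] Let_def
      by (simp only: mult_ac)
  qed
  define \<tau> where "\<tau> i = (if even i then i + 1 else i - 1)" for i :: int
  have "bij \<tau>" by (rule bij_betw_byWitness[of _ \<tau>]) (auto simp: \<tau>_def)
  have "\<Phi> (\<tau> i) = - \<Phi> i" for i
  proof -
    have "\<tau> i div 2 = i div 2" "even (\<tau> i) \<longleftrightarrow> odd i" unfolding \<tau>_def by (auto elim: oddE evenE)
    then show ?thesis by (simp add: \<Phi>_def alternating_def)
  qed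
  moreover have "(\<integral>i. \<Phi> (\<tau> i) \<partial>count_space UNIV) = (\<integral>i. \<Phi> i \<partial>count_space UNIV)"
    using infsetsum_reindex_bij_betw[OF \<open>bij \<tau>\<close>, of \<Phi>] by (simp add: infsetsum_def)
  ultimately have "(\<integral>i. \<Phi> i \<partial>count_space UNIV) = 0" by simp
  then show ?thesis unfolding eq by (subst integral_floor) auto
qed

lemma menshov_orthonormal:
  "has_bochner_integral lborel (\<lambda>x. menshov n x * menshov m x) (if m = n then 1 else 0)"
proof (cases "floor_log (Suc n) = floor_log (Suc m)")
  case True
  then show ?thesis by (rule menshov_same_level)
next
  case False
  then have "(\<integral>x. menshov n x * menshov m x \<partial>lborel) = 0"
    using menshov_cross_level[of n m] menshov_cross_level[of m n]
    by (cases "floor_log (Suc n) < floor_log (Suc m)") (auto simp: mult.commute)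
  moreover have square: "integrable lborel (\<lambda>x. menshov n x * menshov n x)" for n
    using menshov_same_level[of n n] by (simp add: has_bochner_integral_iff)
  have "integrable lborel (\<lambda>x. menshov n x * menshov m x)"
    by (rule integrable_mult_of_squares[OF square square]) (use menshov_measurable in auto)
  ultimately show ?thesis using False by (auto simp: has_bochner_integral_iff)
qed

section \<open>Failure of the rough path property for smaller weights\<close>

lemma harmonic_lower_bound: "ln (real n + 1) \<le> (\<Sum>t<n. 1 / (real t + 1 / 2))"
proof -
  have "ln (real n + 1) \<le> harm n" by (rule ln_le_harm)
  also have "\<dots> = (\<Sum>t<n. 1 / (real t + 1))" by (simp add: harm_altdef inverse_eq_divide add.commute)
  also have "\<dots> \<le> (\<Sum>t<n. 1 / (real t + 1 / 2))" by (intro sum_mono divide_left_mono) auto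
  finally show ?thesis .
qed

text \<open>
  At a point of the \<open>i\<close>-th cell, the partial sums from the first index of the block up to the index of the
  \<open>i\<close>-th translate add the values \<open>h(i), \<dots>, h(0)\<close>, all positive, up to a common factor.
\<close>
lemma menshov_large_increment:
  fixes e :: "'v::real_normed_vector"
  assumes "1 \<le> q" "1 / 2 \<le> x" "x < 1" "norm e = 1"
    and c: "\<And>n. floor_log (Suc n) = q \<Longrightarrow> c n = b / sqrt (2 ^ q)" and "0 \<le> b"
  shows "\<exists>k1 k2. k1 < k2 \<and> b * ((real q - 1) * ln 2) / sqrt hilbert_norm
    \<le> norm (partial_sum_process c (\<lambda>n x. menshov n x *\<^sub>R e) x k1
        - partial_sum_process c (\<lambda>n x. menshov n x *\<^sub>R e) x k2)"
proof -
  let ?X = "partial_sum_process c (\<lambda>n x. menshov n x *\<^sub>R e) x"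
  obtain q' where q': "q = Suc q'" using assms(1) by (cases q) auto
  define i where "i = nat \<lfloor>2 ^ q * x\<rfloor>"
  have fl: "2 ^ q' \<le> \<lfloor>2 ^ q * x\<rfloor>" "\<lfloor>2 ^ q * x\<rfloor> < 2 ^ q"
    using assms(2,3) by (simp_all add: q' le_floor_iff floor_less_iff)
  then have i: "int i = \<lfloor>2 ^ q * x\<rfloor>" unfolding i_def by (metis int_nat_eq zero_le_numeral zero_le_power order_trans)
  then have "int (2 ^ q') \<le> int i" "int i < int (2 ^ q)" using fl by simp_all
  then have i': "2 ^ q' \<le> i" "i < 2 ^ q" by linarith+
  \<comment> \<open>The block starts at index \<open>2\<^sup>q - 1\<close>, and \<open>k1\<close> is the index before it.\<close>
  define k1 k2 where "k1 = 2 ^ q - (2::nat)" and "k2 = 2 ^ q - 1 + i"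
  have pow: "(2::nat) \<le> 2 ^ q" by (simp add: q')
  have k: "k1 < k2" using i' pow by (simp add: k1_def k2_def)
  define S where "S = (\<Sum>j\<le>i. hilbert_kernel (int i - int j))"
  have "?X k2 - ?X k1 = (\<Sum>n\<in>{..k2} - {..k1}. c n *\<^sub>R menshov n x *\<^sub>R e)"
    unfolding partial_sum_process_def using k by (intro sum_diff[symmetric]) auto
  also have "{..k2} - {..k1} = {2 ^ q - 1..2 ^ q - 1 + i}"
    using pow by (auto simp: k1_def k2_def)
  also have "(\<Sum>n\<in>\<dots>. c n *\<^sub>R menshov n x *\<^sub>R e)
      = (\<Sum>j\<le>i. c (2 ^ q - 1 + j) *\<^sub>R menshov (2 ^ q - 1 + j) x *\<^sub>R e)"
    by (rule sum.reindex_bij_witness[of _ "\<lambda>j. 2 ^ q - 1 + j" "\<lambda>n. n - (2 ^ q - 1)"])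
       (use pow in auto)
  also have "\<dots> = (\<Sum>j\<le>i. (b / sqrt (2 ^ q) * (alternating \<lfloor>2 ^ Suc q * x\<rfloor> *
      (sqrt (2 ^ q / hilbert_norm) * hilbert_kernel (int i - int j)))) *\<^sub>R e)"
  proof (intro sum.cong refl)
    fix j assume "j \<in> {..i}"
    have s: "Suc (2 ^ q - 1 + j) = 2 ^ q + j" using pow by simp
    have "floor_log (2 ^ q + j) = q"
      using \<open>j \<in> {..i}\<close> i' by (intro floor_log_eqI) auto
    then have lev: "floor_log (Suc (2 ^ q - 1 + j)) = q" by (simp only: s)
    have "menshov (2 ^ q - 1 + j) x = alternating \<lfloor>2 ^ Suc q * x\<rfloor> *
        (sqrt (2 ^ q / hilbert_norm) * hilbert_kernel (int i - int j))"
      unfolding menshov_def Let_def lev unfolding s i by simp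
    with c[OF lev] show "c (2 ^ q - 1 + j) *\<^sub>R menshov (2 ^ q - 1 + j) x *\<^sub>R e
      = (b / sqrt (2 ^ q) * (alternating \<lfloor>2 ^ Suc q * x\<rfloor> *
          (sqrt (2 ^ q / hilbert_norm) * hilbert_kernel (int i - int j)))) *\<^sub>R e"
      by simp
  qed
  also have "\<dots> = (b / sqrt (2 ^ q) * (alternating \<lfloor>2 ^ Suc q * x\<rfloor> *
      (sqrt (2 ^ q / hilbert_norm) * S))) *\<^sub>R e"
    by (simp only: S_def sum_distrib_left scaleR_sum_left)
  finally have "norm (?X k2 - ?X k1)
      = \<bar>b / sqrt (2 ^ q) * (alternating \<lfloor>2 ^ Suc q * x\<rfloor> * (sqrt (2 ^ q / hilbert_norm) * S))\<bar>"
    using assms(4) by (simp only: norm_scaleR mult_1_right)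
  also have "\<dots> = b / sqrt hilbert_norm * \<bar>S\<bar>"
    using assms(6) hilbert_norm_pos by (simp add: abs_mult real_sqrt_divide alternating_def)
  finally have norm: "norm (?X k1 - ?X k2) = b / sqrt hilbert_norm * \<bar>S\<bar>"
    by (simp add: norm_minus_commute)
  have "S = (\<Sum>t\<le>i. hilbert_kernel (int t))"
    unfolding S_def by (rule sum.reindex_bij_witness[of _ "\<lambda>t. i - t" "\<lambda>t. i - t"]) auto
  also have "\<dots> = (\<Sum>t<Suc i. 1 / (real t + 1 / 2))"
    by (simp add: hilbert_kernel_def flip: lessThan_Suc_atMost)
  finally have S: "ln (real (Suc i) + 1) \<le> S" using harmonic_lower_bound[of "Suc i"] by simp
  have "real (2 ^ q') \<le> real i" using i'(1) by (rule of_nat_mono)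
  then have "2 ^ q' \<le> real (Suc i) + 1" unfolding of_nat_power of_nat_numeral by linarith
  then have "ln (2 ^ q') \<le> ln (real (Suc i) + 1)"
    by (intro ln_mono) auto
  with S have "(real q - 1) * ln 2 \<le> \<bar>S\<bar>" by (simp add: ln_realpow q')
  then have "b / sqrt hilbert_norm * ((real q - 1) * ln 2) \<le> norm (?X k1 - ?X k2)"
    unfolding norm using assms(6) hilbert_norm_pos by (intro mult_left_mono) auto
  then show ?thesis using k by (intro exI[of _ k1] exI[of _ k2]) (simp add: field_simps)
qed

lemma orthonormal_menshov:
  fixes e :: "'v::real_inner"
  assumes "norm e = 1"
  shows "orthonormal_system lborel (\<lambda>n x. menshov n x *\<^sub>R e)"
  unfolding orthonormal_system_def
proof (intro conjI allI)
  fix n m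
  have "(\<lambda>r :: real. r *\<^sub>R e) \<in> borel_measurable borel"
    by (intro borel_measurable_continuous_onI continuous_intros)
  then show "(\<lambda>x. menshov n x *\<^sub>R e) \<in> borel_measurable lborel"
    using measurable_compose[OF menshov_measurable] by simp
  have "e \<bullet> e = 1" using assms by (simp add: dot_square_norm)
  then show "has_bochner_integral lborel (\<lambda>x. (menshov n x *\<^sub>R e) \<bullet> (menshov m x *\<^sub>R e)) (if m = n then 1 else 0)"
    using menshov_orthonormal[of n m] by (cases "m = n") (auto simp: mult.commute)
qed

text \<open>
  The factor \<open>8\<^sup>-\<^sup>k\<close> leaves room for the squares \<open>4\<^sup>k\<close> of growing coefficients.
\<close>
lemma sparse_levels:
  fixes w :: "nat \<Rightarrow> real"
  assumes "w \<in> o(\<lambda>n. (log 2 (real n + 1))\<^sup>2)"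
  shows "\<exists>r. strict_mono r \<and> (\<forall>k. 2 \<le> r k \<and>
    (\<forall>n. 2 ^ r k \<le> Suc n \<longrightarrow> w n \<le> (1 / 8) ^ k * (log 2 (real n + 1))\<^sup>2))"
proof -
  let ?P = "\<lambda>k q. 2 \<le> q \<and> (\<forall>n. 2 ^ q \<le> Suc n \<longrightarrow> w n \<le> (1 / 8) ^ k * (log 2 (real n + 1))\<^sup>2)"
  have ex: "\<exists>q>p. ?P k q" for p k
  proof -
    have "eventually (\<lambda>n. norm (w n) \<le> (1 / 8) ^ k * norm ((log 2 (real n + 1))\<^sup>2)) sequentially"
      by (intro landau_o.smallD[OF assms]) simp
    then obtain n0 where n0: "\<And>n. n0 \<le> n \<Longrightarrow> \<bar>w n\<bar> \<le> (1 / 8) ^ k * (log 2 (real n + 1))\<^sup>2"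
      by (auto simp: eventually_at_top_linorder)
    show ?thesis
    proof (intro exI[of _ "n0 + p + 2"] conjI allI impI)
      fix n assume "2 ^ (n0 + p + 2) \<le> Suc n"
      moreover have "n0 + p + 2 < 2 ^ (n0 + p + 2)" by (rule less_exp)
      ultimately have "n0 \<le> n" by linarith
      from n0[OF this] show "w n \<le> (1 / 8) ^ k * (log 2 (real n + 1))\<^sup>2" by linarith
    qed auto
  qed
  obtain r where "\<And>k. ?P k (r k)" "\<And>k. r k < r (Suc k)"
    using dependent_nat_choice[of ?P "\<lambda>_. (<)"] ex by metis
  then show ?thesis by (intro exI[of _ r]) (auto simp: strict_mono_Suc_iff)
qed

lemma summable_of_dyadic_blocks:
  fixes a :: "nat \<Rightarrow> real"
  assumes "\<And>n. 0 \<le> a n" and g: "summable (\<lambda>q. \<Sum>n=2^q-1..<2^Suc q-1. a n)"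
  shows "summable a"
proof (rule summableI_nonneg_bounded)
  let ?g = "\<lambda>q. \<Sum>n=2^q-1..<2^Suc q-1. a n"
  fix m
  have blocks: "(\<Sum>n<2^Q-1. a n) = (\<Sum>q<Q. ?g q)" for Q
  proof (induction Q)
    case (Suc Q)
    have "(\<Sum>n<2^Suc Q-1. a n) = (\<Sum>n<2^Q-1. a n) + ?g Q"
      unfolding lessThan_atLeast0 by (rule sum.atLeastLessThan_concat[symmetric]) auto
    with Suc show ?case by simp
  qed simp
  have "m \<le> 2 ^ m - 1" using less_exp[of m] by linarith
  then have "(\<Sum>n<m. a n) \<le> (\<Sum>n<2^m-1. a n)" using assms(1) by (intro sum_mono2) auto
  also have "\<dots> \<le> suminf ?g"
    unfolding blocks using assms by (intro sum_le_suminf g) (auto intro: sum_nonneg)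
  finally show "(\<Sum>n<m. a n) \<le> suminf ?g" .
qed (use assms in auto)

text \<open>
  On the \<open>k\<close>-th selected block, of level \<open>q = r k\<close>, the coefficients are \<open>2\<^sup>k / (q sqrt(2\<^sup>q))\<close>; all other
  coefficients vanish. The weighted sum over this block is at most \<open>8\<^sup>-\<^sup>k (q + 1)\<^sup>2 4\<^sup>k / q\<^sup>2 \<le> 4 \<cdot> 2\<^sup>-\<^sup>k\<close>, while the
  increment is of order \<open>2\<^sup>k\<close>.
\<close>
lemma smaller_weight_insufficient:
  fixes w :: "nat \<Rightarrow> real" and \<iota> :: "'v::{real_inner, banach} tensor_square \<Rightarrow> 'e::banach"
  assumes "(v :: 'v) \<noteq> 0" and w_pos: "\<And>n. 0 < w n"
    and w: "w \<in> o(\<lambda>n. (log 2 (real n + 1))\<^sup>2)"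
  shows "\<exists>(u :: nat \<Rightarrow> real \<Rightarrow> 'v) c. orthonormal_system lborel u \<and>
    summable (\<lambda>n. w n * \<bar>c n\<bar>\<^sup>2) \<and> \<not> geometric_rough_process \<iota> lborel (partial_sum_process c u)"
proof -
  define e where "e = sgn v"
  have e: "norm e = 1" using assms(1) by (simp add: e_def norm_sgn)
  obtain r where r: "strict_mono r" "\<And>k. 2 \<le> r k"
    and rw: "\<And>k n. 2 ^ r k \<le> Suc n \<Longrightarrow> w n \<le> (1 / 8) ^ k * (log 2 (real n + 1))\<^sup>2"
    using sparse_levels[OF w] by blast
  have inj: "inj r" using r(1) by (rule strict_mono_imp_inj_on)
  define \<beta> where "\<beta> q = (if q \<in> range r then 2 ^ inv r q / real q else 0)" for q
  have \<beta>: "\<beta> (r k) = 2 ^ k / real (r k)" for k using inj by (simp add: \<beta>_def)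
  define c where "c n = \<beta> (floor_log (Suc n)) / sqrt (2 ^ floor_log (Suc n))" for n
  have level: "floor_log (Suc n) = q" if "n \<in> {2^q-1..<2^Suc q-1}" for n q
    using that by (intro floor_log_eqI) auto
  let ?g = "\<lambda>q. \<Sum>n=2^q-1..<2^Suc q-1. w n * \<bar>c n\<bar>\<^sup>2"
  have g0: "?g q = 0" if "q \<notin> range r" for q
    using that level by (intro sum.neutral) (simp add: c_def \<beta>_def)
  have g_le: "?g (r k) \<le> 4 * (1 / 2) ^ k" for k
  proof -
    have "?g (r k) \<le> (\<Sum>n=(2::nat)^r k-1..<2^Suc (r k)-1. 4 * (1 / 2) ^ k / 2 ^ r k)"
    proof (intro sum_mono)
      fix n :: nat assume n: "n \<in> {2^r k-1..<2^Suc (r k)-1}"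
      have rk: "2 \<le> real (r k)" using r(2)[of k] by simp
      have n1: "2 ^ r k \<le> Suc n" and n2: "Suc n \<le> 2 ^ Suc (r k)" using n by auto
      have "real (Suc n) \<le> real (2 ^ Suc (r k))" using n2 by (rule of_nat_mono)
      then have "real n + 1 \<le> 2 ^ Suc (r k)" by simp
      then have "log 2 (real n + 1) \<le> log 2 (2 ^ Suc (r k))" by (subst log_le_cancel_iff) auto
      also have "\<dots> = real (r k) + 1" by (subst log_nat_power) auto
      also have "\<dots> \<le> 2 * real (r k)" using rk by simp
      finally have "(log 2 (real n + 1))\<^sup>2 \<le> (2 * real (r k))\<^sup>2" by (intro power_mono) auto
      then have "(1 / 8) ^ k * (log 2 (real n + 1))\<^sup>2 \<le> (1 / 8) ^ k * (2 * real (r k))\<^sup>2"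
        by (intro mult_left_mono) auto
      with rw[OF n1] have "w n \<le> (1 / 8) ^ k * (2 * real (r k))\<^sup>2" by linarith
      moreover have "\<bar>c n\<bar>\<^sup>2 = (2 ^ k / real (r k))\<^sup>2 / 2 ^ r k"
        unfolding c_def level[OF n] \<beta> by (simp add: power_divide power_mult_distrib)
      ultimately have "w n * \<bar>c n\<bar>\<^sup>2 \<le> (1 / 8) ^ k * (2 * real (r k))\<^sup>2 * ((2 ^ k / real (r k))\<^sup>2 / 2 ^ r k)"
        by (simp only:) (intro mult_right_mono, auto)
      also have "\<dots> = 4 * ((1 / 8) ^ k * (2 ^ k)\<^sup>2) / 2 ^ r k"
        using rk by (simp add: power_divide power_mult_distrib)
      also have "(1 / 8 :: real) ^ k * (2 ^ k)\<^sup>2 = (1 / 2) ^ k"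
        by (simp add: power2_eq_square flip: power_mult_distrib)
      finally show "w n * \<bar>c n\<bar>\<^sup>2 \<le> 4 * (1 / 2) ^ k / 2 ^ r k" .
    qed
    also have "\<dots> = 4 * (1 / 2) ^ k" by simp
    finally show ?thesis .
  qed
  have "summable (\<lambda>k. ?g (r k))"
  proof (rule summable_comparison_test')
    show "summable (\<lambda>k. 4 * (1 / 2 :: real) ^ k)" by (intro summable_mult summable_geometric) simp
    have "0 \<le> ?g (r k)" for k using w_pos by (intro sum_nonneg) (simp add: less_imp_le)
    then show "norm (?g (r k)) \<le> 4 * (1 / 2) ^ k" for k using g_le[of k] by simp
  qed
  then have "summable ?g" using summable_mono_reindex[of r ?g] r(1) g0 by blast
  then have sum: "summable (\<lambda>n. w n * \<bar>c n\<bar>\<^sup>2)"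
    by (rule summable_of_dyadic_blocks[rotated]) (simp add: w_pos less_imp_le)
  let ?u = "\<lambda>n x. menshov n x *\<^sub>R e"
  have rough: "\<not> geometric_rough_path \<iota> (partial_sum_process c ?u x)" if x: "1 / 2 \<le> x" "x < 1" for x
  proof
    assume "geometric_rough_path \<iota> (partial_sum_process c ?u x)"
    then obtain B where B: "\<And>k1 k2. k1 < k2 \<Longrightarrow>
        norm (partial_sum_process c ?u x k1 - partial_sum_process c ?u x k2) \<le> B"
      using rough_norm_finite_imp_bounded unfolding geometric_rough_path_def by blast
    define \<delta> where "\<delta> = ln 2 / (2 * sqrt hilbert_norm)"
    have "\<delta> > 0" using hilbert_norm_pos by (simp add: \<delta>_def)
    have "2 ^ k * \<delta> \<le> B" for k
    proof -
      have rk: "2 \<le> real (r k)" using r(2)[of k] by simp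
      have "\<beta> (r k) * ((real (r k) - 1) * ln 2) / sqrt hilbert_norm \<le> B"
      proof -
        have "1 \<le> r k" "0 \<le> \<beta> (r k)" using r(2)[of k] by (auto simp: \<beta>)
        moreover have "c n = \<beta> (r k) / sqrt (2 ^ r k)" if "floor_log (Suc n) = r k" for n
          using that by (simp add: c_def)
        ultimately obtain k1 k2 where "k1 < k2" "\<beta> (r k) * ((real (r k) - 1) * ln 2) / sqrt hilbert_norm
            \<le> norm (partial_sum_process c ?u x k1 - partial_sum_process c ?u x k2)"
          using menshov_large_increment[of "r k" x e c "\<beta> (r k)"] x e by blast
        with B[of k1 k2] show ?thesis by linarith
      qed
      moreover have "2 ^ k * \<delta> = 2 ^ k * (1 / 2) * ln 2 / sqrt hilbert_norm" by (simp add: \<delta>_def)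
      moreover have "1 / 2 \<le> (real (r k) - 1) / real (r k)" using rk by (simp add: field_simps)
      then have "2 ^ k * (1 / 2) * ln 2 / sqrt hilbert_norm
          \<le> 2 ^ k * ((real (r k) - 1) / real (r k)) * ln 2 / sqrt hilbert_norm"
        using hilbert_norm_pos by (intro divide_right_mono mult_right_mono mult_left_mono) auto
      moreover have "2 ^ k * ((real (r k) - 1) / real (r k)) * ln 2 / sqrt hilbert_norm
          = \<beta> (r k) * ((real (r k) - 1) * ln 2) / sqrt hilbert_norm"
        by (simp add: \<beta>)
      ultimately show ?thesis by linarith
    qed
    then have "2 ^ k \<le> B / \<delta>" for k using \<open>\<delta> > 0\<close> by (simp add: pos_le_divide_eq)
    moreover obtain k where "B / \<delta> < 2 ^ k" using real_arch_pow[of 2 "B / \<delta>"] by auto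
    ultimately show False by (meson not_le)
  qed
  have "\<not> geometric_rough_process \<iota> lborel (partial_sum_process c ?u)"
  proof
    assume "geometric_rough_process \<iota> lborel (partial_sum_process c ?u)"
    then have "AE x in lborel. x \<notin> {1/2..<1 :: real}"
      unfolding geometric_rough_process_def by eventually_elim (use rough in auto)
    then have "emeasure lborel {1/2..<1 :: real} = 0"
      by (subst (asm) AE_iff_measurable[of "{1/2..<1}"]) auto
    then show False by simp
  qed
  then show ?thesis using orthonormal_menshov[OF e] sum by blast
qed

section \<open>The Menshov-Rademacher theorem for rough paths\<close>

theorem theorem14:
  fixes N :: "'v::{real_inner, banach} tensor_square \<Rightarrow> real"
    and \<iota> :: "'v tensor_square \<Rightarrow> 'e::banach"
  assumes "tensor_norm N"
    and "tensor_completion N \<iota>"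
  shows
    "(\<forall>(M :: 'a measure) (u :: nat \<Rightarrow> 'a \<Rightarrow> 'v) (c :: nat \<Rightarrow> real).
        orthonormal_system M u \<longrightarrow>
        summable (\<lambda>n. (log 2 (real n + 1))\<^sup>2 * \<bar>c n\<bar>\<^sup>2) \<longrightarrow>
          geometric_rough_process \<iota> M (partial_sum_process c u) \<and>
          (\<integral>\<^sup>+ \<omega>. (rough_norm (partial_sum_process c u \<omega>) (area \<iota> (partial_sum_process c u \<omega>)))\<^sup>2 \<partial>M)
            \<le> ennreal (121 * suminf (\<lambda>n. (log 2 (real n + 1))\<^sup>2 * \<bar>c n\<bar>\<^sup>2)))
     \<and>
     ((\<exists>v :: 'v. v \<noteq> 0) \<longrightarrow>
      (\<forall>w :: nat \<Rightarrow> real.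
         (\<forall>n. 0 < w n) \<longrightarrow> mono w \<longrightarrow> w \<in> o(\<lambda>n. (log 2 (real n + 1))\<^sup>2) \<longrightarrow>
         (\<exists>(M :: real measure) (u :: nat \<Rightarrow> real \<Rightarrow> 'v) (c :: nat \<Rightarrow> real).
            orthonormal_system M u \<and>
            summable (\<lambda>n. w n * \<bar>c n\<bar>\<^sup>2) \<and>
            \<not> geometric_rough_process \<iota> M (partial_sum_process c u))))"
proof (intro conjI allI impI)
  fix M :: "'a measure" and u :: "nat \<Rightarrow> 'a \<Rightarrow> 'v" and c :: "nat \<Rightarrow> real"
  assume u: "orthonormal_system M u"
    and c: "summable (\<lambda>n. (log 2 (real n + 1))\<^sup>2 * \<bar>c n\<bar>\<^sup>2)"
  show "geometric_rough_process \<iota> M (partial_sum_process c u)"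
    by (rule nn_integral_rough_norm_le(1)[OF assms u c])
  have "0 \<le> suminf (\<lambda>n. (log 2 (real n + 1))\<^sup>2 * \<bar>c n\<bar>\<^sup>2)"
    by (intro suminf_nonneg c) auto
  then have "ennreal (30 * suminf (\<lambda>n. (log 2 (real n + 1))\<^sup>2 * \<bar>c n\<bar>\<^sup>2))
      \<le> ennreal (121 * suminf (\<lambda>n. (log 2 (real n + 1))\<^sup>2 * \<bar>c n\<bar>\<^sup>2))"
    by (intro ennreal_leI mult_right_mono) auto
  with nn_integral_rough_norm_le(2)[OF assms u c]
  show "(\<integral>\<^sup>+ \<omega>. (rough_norm (partial_sum_process c u \<omega>) (area \<iota> (partial_sum_process c u \<omega>)))\<^sup>2 \<partial>M)
      \<le> ennreal (121 * suminf (\<lambda>n. (log 2 (real n + 1))\<^sup>2 * \<bar>c n\<bar>\<^sup>2))"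
    by (rule order_trans)
next
  fix w :: "nat \<Rightarrow> real"
  assume "\<exists>v :: 'v. v \<noteq> 0" and w: "\<forall>n. 0 < w n" "w \<in> o(\<lambda>n. (log 2 (real n + 1))\<^sup>2)"
  then obtain v :: 'v where "v \<noteq> 0" by blast
  from smaller_weight_insufficient[OF this, of w \<iota>] w
  show "\<exists>(M :: real measure) (u :: nat \<Rightarrow> real \<Rightarrow> 'v) (c :: nat \<Rightarrow> real).
      orthonormal_system M u \<and> summable (\<lambda>n. w n * \<bar>c n\<bar>\<^sup>2) \<and>
      \<not> geometric_rough_process \<iota> M (partial_sum_process c u)"
    by blast
qed

end
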